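(* For every prime power $q$ there exists a set $\mathcal X$ of $\frac{q^6-1}{q-1}$ points of $\mathrm{PG}(13,q)$ which is a $(3,2)$-set and which is transitive, i.e. the group of projectivities of $\mathrm{PG}(13,q)$ stabilizing $\mathcal X$ acts transitively on the points of $\mathcal X$.
   Context: For integers $r,s$, an $(r,s)$-set of $\mathrm{PG}(n,q)$ is a set $\mathcal X$ of points such that: (i) every $s$-dimensional projective subspace contains at most $r$ points of $\mathcal X$; (ii) $\mathcal X$ spans $\mathrm{PG}(n,q)$; (iii) some $(s+1)$-dimensional projective subspace contains $r+2$ points of $\mathcal X$. *)

theory Defs
  imports "HOL-Analysis.Analysis" "HOL-Library.Numeral_Type"
begin

text \<open>Projective geometry PG(n,q) modelled on the vector space 'a^'m over a finite
field 'a, with CARD('m) = n+1 and CARD('a) = q.  Projective subspaces of projective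
dimension s are the vector subspaces of dimension s+1; points are those of dimension 1.\<close>

definition proj_subspaces :: "nat \<Rightarrow> ('a::field ^ 'm) set set" where
  "proj_subspaces s = {W. vec.subspace W \<and> vec.dim W = s + 1}"

definition proj_points :: "('a::field ^ 'm) set set" where
  "proj_points = proj_subspaces 0"

definition pts_in :: "('a::field ^ 'm) set set \<Rightarrow> ('a ^ 'm) set \<Rightarrow> ('a ^ 'm) set set" where
  "pts_in X W = {p \<in> X. p \<subseteq> W}"

definition rs_set :: "nat \<Rightarrow> nat \<Rightarrow> ('a::field ^ 'm) set set \<Rightarrow> bool" where
  "rs_set r s X \<longleftrightarrow>
     X \<subseteq> proj_points \<and>
     (\<forall>W \<in> proj_subspaces s. card (pts_in X W) \<le> r) \<and>
     vec.span (\<Union>X) = UNIV \<and>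
     (\<exists>W \<in> proj_subspaces (s + 1). card (pts_in X W) = r + 2)"

definition projectivity :: "'a::field ^ 'm ^ 'm \<Rightarrow> ('a ^ 'm) set \<Rightarrow> ('a ^ 'm) set" where
  "projectivity A p = (\<lambda>v. A *v v) ` p"

definition transitive_pointset :: "('a::field ^ 'm) set set \<Rightarrow> bool" where
  "transitive_pointset X \<longleftrightarrow>
     (\<forall>p \<in> X. \<forall>p' \<in> X. \<exists>A :: 'a ^ 'm ^ 'm. invertible A \<and>
        projectivity A ` X = X \<and> projectivity A p = p')"

end

theory Submission
  imports Defs "HOL-Algebra.Algebraic_Closure_Type" "HOL-Library.Function_Algebras"
begin

text \<open>
  Write x_i for the conjugate x^(q^i) of an element x of F_(q^6). The points are spanned by the
  vectors v(x) = (x_0 x_3 x_1, x_0 x_3 x_2, x_0 x_2 x_4), which live in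
  F_(q^6) + F_(q^6) + F_(q^2), a space of dimension 6 + 6 + 2 = 14 over F_q. Since v is
  multiplicative, the point set is an orbit of the multiplicative group of F_(q^6); it spans
  because the 14 conjugate monomials occurring in v are linearly independent functions.

  Suppose that at most four points satisfy a relation with coefficients a. The weighted vectors
  a x_0 x_2, a x_1 x_3 and a x_0 x_3 are all orthogonal to x_4 and x_5, so they are linearly
  dependent. In terms of r = x_1 / x_0 this says that r is a Moebius transform of r^(q^2), the
  same one for all points; its third iterate has at least three fixed points and is
  the identity. After rescaling r, the functions 1, r, 1/(1+r), 1/r annihilate the weights
  a x_0 x_2 x_4, and a Vandermonde argument shows that the weights vanish.

  Five dependent points spanning a solid without a sixth point are 1, e, 1/e, t, t_3 with e in
  F_(q^3). Here t is a root of a quadratic polynomial over F_(q^3) with coefficients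
  l + \<rho> + 1/\<rho> and \<mu>, where \<rho> is a conjugate of e_1/e; the parameters l and \<mu> in F_q are
  chosen such that the norm of t to F_(q^2) has trace \<mu> (l + 2).
\<close>

section \<open>Independence of any four points\<close>

text \<open>The monomials in use are the triples of conjugates outside the orbit of {0,1,2}: 14 of
  the 20 three-element subsets of the integers modulo 6. Coefficients from F_q are fixed by
  conjugation, so a linear relation between points holds for each of these monomials. The five
  points arise as follows. If t t_3 = \<mu> and t + t_3 = l + \<rho> + 1/\<rho>, the first two
  coordinates of v(t) + v(t_3) are those of a combination of v(1), v(e), v(1/e). The third
  coordinate adds the trace condition, in which l + 2 collects the contributions l, 1, 1 of the
  points 1, e, 1/e. The norm of t to F_(q^2) is therefore sought as \<mu> Z, where Z and its
  conjugate Z' have sum l + 2 and product \<mu>. Eliminating t leaves one resultant equation in l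
  and \<mu>. Putting Z = 1 + l \<eta> with \<eta> of trace 1 meets the condition on the sum without
  a division by 2, so that even q is no special case, and makes the resultant equation linear in l
  up to trivial factors.\<close>

lemma weighted_power_sums_zero_imp_zero:
  fixes w r :: "'i \<Rightarrow> 'b::field"
  assumes "finite I" "inj_on r I"
    and pw: "\<And>k. k < card I \<Longrightarrow> (\<Sum>i\<in>I. w i * r i ^ k) = 0"
    and "i \<in> I"
  shows "w i = 0"
proof -
  \<comment> \<open>The vanishing power sums say that the functional f -> sum of
    \<open>w j * f (r j)\<close> kills all polynomials of degree below \<open>card I\<close>;
    \<open>p\<close> is one of them and vanishes at every node except \<open>r i\<close>.\<close>
  define p where "p = (\<Prod>j\<in>I - {i}. [:- r j, 1:])"
  have poly_p: "poly p x = (\<Prod>j\<in>I - {i}. x - r j)" for x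
    by (simp add: p_def poly_prod)
  have "Polynomial.degree p = card (I - {i})"
    by (simp add: p_def degree_prod_eq_sum_degree)
  then have deg: "Polynomial.degree p < card I"
    using assms by (metis card_Diff1_less)
  have "(\<Sum>j\<in>I. w j * poly p (r j)) = (\<Sum>j\<in>I. \<Sum>k\<le>Polynomial.degree p. Polynomial.coeff p k * (w j * r j ^ k))"
    by (simp add: poly_altdef sum_distrib_left mult_ac)
  also have "\<dots> = (\<Sum>k\<le>Polynomial.degree p. Polynomial.coeff p k * (\<Sum>j\<in>I. w j * r j ^ k))"
    by (subst sum.swap) (simp add: sum_distrib_left)
  also have "\<dots> = 0" using pw deg by (intro sum.neutral) auto
  finally have "(\<Sum>j\<in>I. w j * poly p (r j)) = 0" .
  moreover have "(\<Sum>j\<in>I. w j * poly p (r j)) = w i * poly p (r i)"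
  proof -
    have "poly p (r j) = 0" if "j \<in> I - {i}" for j
      using that \<open>finite I\<close> unfolding poly_p by (intro prod_zero) auto
    then show ?thesis using assms by (subst sum.remove[of I i]) (auto intro!: sum.neutral)
  qed
  moreover have "poly p (r i) \<noteq> 0"
    using assms by (auto simp: poly_p inj_on_def)
  ultimately show ?thesis by simp
qed

text \<open>The cross product of the two coefficient rows is a solution. When it is zero the rows
  are proportional, and a solution for a nonzero row serves for both.\<close>

lemma two_equations_three_unknowns:
  fixes a b c d e f :: "'b::field"
  obtains x y z where "(x, y, z) \<noteq> (0, 0, 0)" "a * x + b * y + c * z = 0" "d * x + e * y + f * z = 0"
proof (cases "b * f - c * e = 0 \<and> c * d - a * f = 0 \<and> a * e - b * d = 0")
  case False
  then show thesis
    by (intro that[of "b * f - c * e" "c * d - a * f" "a * e - b * d"]) (auto simp: algebra_simps)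
next
  case True
  show thesis
  proof (cases "a = 0 \<and> b = 0 \<and> c = 0")
    case abc: True
    show thesis
    proof (cases "d = 0")
      case True
      then show thesis using abc by (intro that[of 1 0 0]) auto
    next
      case False
      then show thesis using abc by (intro that[of "- e" d 0]) auto
    qed
  next
    case False
    with True show thesis
    proof (cases "a = 0")
      case True
      with \<open>_ \<and> _ \<and> _\<close> False show thesis
        by (cases "b = 0") (auto intro!: that[of 0 "- c" b] that[of 1 0 0] simp: algebra_simps)
    next
      case False
      with \<open>_ \<and> _ \<and> _\<close> show thesis
        by (intro that[of "- b" a 0]) (auto simp: algebra_simps)
    qed
  qed
qed

text \<open>F_q and F_(q^6) enter as the fixed elements of \<open>frob\<close> and of its sixth
  iterate, so computing with conjugates becomes rewriting with homomorphism rules.\<close>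

locale field_endomorphism =
  fixes frob :: "'b::field \<Rightarrow> 'b"
  assumes frob_add [simp]: "frob (x + y) = frob x + frob y"
    and frob_mult [simp]: "frob (x * y) = frob x * frob y"
    and frob_1 [simp]: "frob 1 = 1"
begin

lemma frob_0 [simp]: "frob 0 = 0"
  by (metis add_cancel_right_right add_0 frob_add)

lemma frob_minus [simp]: "frob (- x) = - frob x"
  using frob_add[of x "- x"] by (simp add: eq_neg_iff_add_eq_0 add.commute del: frob_add)

lemma frob_diff [simp]: "frob (x - y) = frob x - frob y"
  using frob_add[of x "- y"] by (simp del: frob_add)

lemma frob_eq_0_iff [simp]: "frob x = 0 \<longleftrightarrow> x = 0"
proof
  assume "frob x = 0"
  show "x = 0"
  proof (rule ccontr)
    assume "x \<noteq> 0"
    then have "frob x * frob (inverse x) = 1" by (simp flip: frob_mult)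
    with \<open>frob x = 0\<close> show False by simp
  qed
qed simp

lemma frob_eq_iff [simp]: "frob x = frob y \<longleftrightarrow> x = y"
  using frob_eq_0_iff[of "x - y"] by (simp del: frob_eq_0_iff)

lemma frob_inverse [simp]: "frob (inverse x) = inverse (frob x)"
proof (cases "x = 0")
  case False
  then have "frob x * frob (inverse x) = 1" by (simp flip: frob_mult)
  then show ?thesis by (simp add: inverse_unique)
qed simp

lemma frob_divide [simp]: "frob (x / y) = frob x / frob y"
  by (simp add: divide_inverse)

lemma frob_power [simp]: "frob (x ^ n) = frob x ^ n"
  by (induction n) simp_all

lemma frob_sum [simp]: "frob (\<Sum>i\<in>A. f i) = (\<Sum>i\<in>A. frob (f i))"
  by (induction A rule: infinite_finite_induct) simp_all

lemma frob_prod [simp]: "frob (\<Prod>i\<in>A. f i) = (\<Prod>i\<in>A. frob (f i))"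
  by (induction A rule: infinite_finite_induct) simp_all

lemma frob_of_nat [simp]: "frob (of_nat n) = of_nat n"
  by (induction n) simp_all

lemma frob_numeral [simp]: "frob (numeral n) = numeral n"
  using frob_of_nat[of "numeral n"] by simp

text \<open>The vector (n x^q, n x^(q^2), N), where n and N are the norms of x from F_(q^6) to
  F_(q^3) and to F_(q^2).\<close>

definition point_vec :: "'b \<Rightarrow> 'b \<times> 'b \<times> 'b" where
  "point_vec x = (x * frob (frob (frob x)) * frob x, x * frob (frob (frob x)) * frob (frob x),
     x * frob (frob x) * frob (frob (frob (frob x))))"

definition K6 :: "'b set" where
  "K6 = {x. frob (frob (frob (frob (frob (frob x))))) = x}"

text \<open>Eliminating the conjugates of r from a Moebius relation between r and r^(q^2).\<close>

lemma frob_frob_eq_quadratic: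
  assumes 0: "a + b * r * frob (frob r) + c * frob (frob r) = 0"
    and r: "r \<in> K6"
    and abc: "a2 = frob (frob a)" "b2 = frob (frob b)" "c2 = frob (frob c)"
      "a4 = frob (frob a2)" "b4 = frob (frob b2)" "c4 = frob (frob c2)"
  shows "(c4 * c2 * b - b4 * a2 * b) * r\<^sup>2
    + (a4 * c2 * b + c4 * c2 * c - c4 * a * b2 - b4 * a2 * c) * r + a4 * (c2 * c - a * b2) = 0"
proof -
  define r2 where "r2 = frob (frob r)"
  define r4 where "r4 = frob (frob r2)"
  have r0: "frob (frob r4) = r" using r by (simp add: K6_def r2_def r4_def)
  have e0: "a + b * r * r2 + c * r2 = 0" using 0 by (simp add: r2_def)
  have "frob (frob (a + b * r * r2 + c * r2)) = 0" by (simp only: e0 frob_0)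
  then have e2: "a2 + b2 * r2 * r4 + c2 * r4 = 0" by (simp add: abc r2_def r4_def)
  have "frob (frob (a2 + b2 * r2 * r4 + c2 * r4)) = 0" by (simp only: e2 frob_0)
  then have e4: "a4 + b4 * r4 * r + c4 * r = 0" by (simp add: abc r0 flip: r4_def)
  \<comment> \<open>This combination of \<open>e0\<close> and \<open>e2\<close> eliminates
    \<open>r2\<close>; what is left relates \<open>r\<close> and \<open>r4\<close>, and
    \<open>e4\<close> relates them a second time.\<close>
  have "a2 * (b * r + c) + r4 * (c2 * (b * r + c) - a * b2) =
      (b * r + c) * (a2 + b2 * r2 * r4 + c2 * r4) - b2 * r4 * (a + b * r * r2 + c * r2)"
    by (simp add: algebra_simps)
  then have T: "a2 * (b * r + c) = - (r4 * (c2 * (b * r + c) - a * b2))"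
    by (simp add: e0 e2 eq_neg_iff_add_eq_0)
  have "(c4 * c2 * b - b4 * a2 * b) * r\<^sup>2
    + (a4 * c2 * b + c4 * c2 * c - c4 * a * b2 - b4 * a2 * c) * r + a4 * (c2 * c - a * b2) =
    (a4 + c4 * r) * (c2 * (b * r + c) - a * b2) - b4 * r * (a2 * (b * r + c))"
    by (simp add: algebra_simps power2_eq_square)
  also have "\<dots> = (a4 + b4 * r4 * r + c4 * r) * (c2 * (b * r + c) - a * b2)"
    by (simp only: T) (simp add: algebra_simps)
  also have "\<dots> = 0" by (simp add: e4)
  finally show ?thesis .
qed


text \<open>The dependency is given by its support: all weights are nonzero, and being fixed by
  \<open>frob\<close> they allow each of the three equations to be conjugated. The hypothesis
  \<open>inj\<close> expresses that the points are distinct.\<close>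

theorem point_vec_independent:
  fixes x a :: "'i \<Rightarrow> 'b"
  assumes fin: "finite I" and le4: "card I \<le> 4" and ne: "I \<noteq> {}"
    and x: "\<And>i. i \<in> I \<Longrightarrow> x i \<in> K6" "\<And>i. i \<in> I \<Longrightarrow> x i \<noteq> 0"
    and inj: "inj_on (\<lambda>i. frob (x i) / x i) I"
    and a: "\<And>i. i \<in> I \<Longrightarrow> frob (a i) = a i" "\<And>i. i \<in> I \<Longrightarrow> a i \<noteq> 0"
    and A: "(\<Sum>i\<in>I. a i * fst (point_vec (x i))) = 0"
    and B: "(\<Sum>i\<in>I. a i * fst (snd (point_vec (x i)))) = 0"
    and C: "(\<Sum>i\<in>I. a i * snd (snd (point_vec (x i)))) = 0"
  shows False
proof -
  define b where "b i = a i" for i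
  define x0 where "x0 i = x i" for i
  define x1 where "x1 i = frob (x0 i)" for i
  define x2 where "x2 i = frob (x1 i)" for i
  define x3 where "x3 i = frob (x2 i)" for i
  define x4 where "x4 i = frob (x3 i)" for i
  define x5 where "x5 i = frob (x4 i)" for i
  note xs = x1_def x2_def x3_def x4_def x5_def
  have x6: "frob (x5 i) = x0 i" if "i \<in> I" for i
    using x(1)[OF that] by (simp add: xs x0_def K6_def)
  have fb: "frob (b i) = b i" if "i \<in> I" for i using a(1)[OF that] by (simp add: b_def)
  have nz: "b i \<noteq> 0" "x0 i \<noteq> 0" "x1 i \<noteq> 0" "x2 i \<noteq> 0" "x3 i \<noteq> 0" "x4 i \<noteq> 0" "x5 i \<noteq> 0" if "i \<in> I" for i
    using x(2)[OF that] a(2)[OF that] by (simp_all add: b_def x0_def xs)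
  have frob_shift: "(\<Sum>i\<in>I. g i) = 0" if "(\<Sum>i\<in>I. f i) = 0" "\<And>i. i \<in> I \<Longrightarrow> frob (f i) = g i" for f g :: "'i \<Rightarrow> 'b"
  proof -
    have "(\<Sum>i\<in>I. g i) = frob (\<Sum>i\<in>I. f i)" using that(2) by simp
    then show ?thesis by (simp only: that(1) frob_0)
  qed
  \<comment> \<open>The digits in these names list the conjugates in the monomial; applying
    \<open>frob\<close> raises each digit by one modulo 6.\<close>
  have s031: "(\<Sum>i\<in>I. b i * (x0 i * x3 i * x1 i)) = 0"
    using A by (simp add: b_def point_vec_def x0_def xs)
  have s032: "(\<Sum>i\<in>I. b i * (x0 i * x3 i * x2 i)) = 0"
    using B by (simp add: b_def point_vec_def x0_def xs)
  have s024: "(\<Sum>i\<in>I. b i * (x0 i * x2 i * x4 i)) = 0"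
    using C by (simp add: b_def point_vec_def x0_def xs)
  note xsym = x1_def[symmetric] x2_def[symmetric] x3_def[symmetric] x4_def[symmetric] x5_def[symmetric]
  have s142: "(\<Sum>i\<in>I. b i * (x1 i * x4 i * x2 i)) = 0"
    by (rule frob_shift[OF s031]) (simp add: fb xsym)
  have s253: "(\<Sum>i\<in>I. b i * (x2 i * x5 i * x3 i)) = 0"
    by (rule frob_shift[OF s142]) (simp add: fb xsym)
  have s304: "(\<Sum>i\<in>I. b i * (x3 i * x0 i * x4 i)) = 0"
    by (rule frob_shift[OF s253]) (simp add: fb xsym x6)
  have s415: "(\<Sum>i\<in>I. b i * (x4 i * x1 i * x5 i)) = 0"
    by (rule frob_shift[OF s304]) (simp add: fb xsym)
  have s520: "(\<Sum>i\<in>I. b i * (x5 i * x2 i * x0 i)) = 0"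
    by (rule frob_shift[OF s415]) (simp add: fb xsym x6)
  have s143: "(\<Sum>i\<in>I. b i * (x1 i * x4 i * x3 i)) = 0"
    by (rule frob_shift[OF s032]) (simp add: fb xsym)
  have s254: "(\<Sum>i\<in>I. b i * (x2 i * x5 i * x4 i)) = 0"
    by (rule frob_shift[OF s143]) (simp add: fb xsym)
  have s305: "(\<Sum>i\<in>I. b i * (x3 i * x0 i * x5 i)) = 0"
    by (rule frob_shift[OF s254]) (simp add: fb xsym x6)
  have s135: "(\<Sum>i\<in>I. b i * (x1 i * x3 i * x5 i)) = 0"
    by (rule frob_shift[OF s024]) (simp add: fb xsym)
  define r where "r i = x1 i / x0 i" for i
  have inj_r: "inj_on r I" using inj by (simp add: r_def[abs_def] x0_def x1_def)
  have r2: "frob (frob (r i)) = x3 i / x2 i" for i by (simp add: r_def xsym)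
  have r4: "frob (frob (frob (frob (r i)))) = x5 i / x4 i" for i by (simp add: r_def xsym)
  have inj_r4: "inj_on (\<lambda>i. x5 i / x4 i) I"
    using inj_r by (auto simp: inj_on_def r4[symmetric])
  \<comment> \<open>The ratios \<open>x5 / x4\<close> are conjugates of the distinct
    \<open>r i\<close>, so over at most two indices the vectors \<open>x4\<close> and
    \<open>x5\<close> leave no room for a nonzero orthogonal \<open>h\<close>.\<close>
  have zero_if: "h i = 0"
    if "J \<subseteq> I" "card J \<le> 2" "(\<Sum>i\<in>J. h i * x4 i) = 0" "(\<Sum>i\<in>J. h i * x5 i) = 0" "i \<in> J" for h J i
  proof -
    have "finite J" using that(1) fin finite_subset by blast
    have "h i * x4 i = 0"
    proof (rule weighted_power_sums_zero_imp_zero[OF \<open>finite J\<close>, of "\<lambda>i. x5 i / x4 i" "\<lambda>i. h i * x4 i"])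
      show "inj_on (\<lambda>i. x5 i / x4 i) J" using inj_r4 that(1) inj_on_subset by blast
      fix k assume "k < card J"
      then have "k = 0 \<or> k = 1" using that(2) by linarith
      moreover have "(\<Sum>i\<in>J. h i * x4 i * (x5 i / x4 i)) = (\<Sum>i\<in>J. h i * x5 i)"
        using nz that(1) by (intro sum.cong) auto
      ultimately show "(\<Sum>i\<in>J. h i * x4 i * (x5 i / x4 i) ^ k) = 0"
        using that(3,4) by auto
    qed (use that in auto)
    then show ?thesis using nz that(1,5) by auto
  qed
  have "card I > 2"
  proof (rule ccontr)
    assume "\<not> card I > 2"
    then have "b i * x0 i * x2 i = 0" if "i \<in> I" for i
      using s024 s520 that by (intro zero_if[of I "\<lambda>i. b i * x0 i * x2 i" i]) (simp_all add: mult_ac)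
    then show False using ne nz by auto
  qed
  have "\<exists>\<alpha> \<beta> \<gamma>. (\<alpha>, \<beta>, \<gamma>) \<noteq> (0, 0, 0) \<and> (\<forall>i\<in>I. \<alpha> * (x0 i * x2 i) + \<beta> * (x1 i * x3 i) + \<gamma> * (x0 i * x3 i) = 0)"
  proof -
    obtain J where J: "J \<subseteq> I" "card J = 2" "finite J"
      using obtain_subset_with_card_n[of 2 I] \<open>card I > 2\<close> by auto
    then obtain i j where ij: "J = {i, j}" "i \<noteq> j" by (meson card_2_iff)
    \<comment> \<open>The combination is chosen to vanish at the two indices in \<open>J\<close>. At
      most two indices remain, and there \<open>zero_if\<close> applies, because the combination is
      still orthogonal to \<open>x4\<close> and \<open>x5\<close>.\<close>
    obtain \<alpha> \<beta> \<gamma> where z: "(\<alpha>, \<beta>, \<gamma>) \<noteq> (0, 0, 0)"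
      "(x0 i * x2 i) * \<alpha> + (x1 i * x3 i) * \<beta> + (x0 i * x3 i) * \<gamma> = 0"
      "(x0 j * x2 j) * \<alpha> + (x1 j * x3 j) * \<beta> + (x0 j * x3 j) * \<gamma> = 0"
      by (rule two_equations_three_unknowns)
    define h where "h l = \<alpha> * (x0 l * x2 l) + \<beta> * (x1 l * x3 l) + \<gamma> * (x0 l * x3 l)" for l
    have hJ: "h l = 0" if "l \<in> J" for l
      using z that ij(1) by (auto simp: h_def mult_ac)
    have "(\<Sum>l\<in>I. b l * h l * x4 l) = \<alpha> * (\<Sum>i\<in>I. b i * (x0 i * x2 i * x4 i))
        + \<beta> * (\<Sum>i\<in>I. b i * (x1 i * x4 i * x3 i)) + \<gamma> * (\<Sum>i\<in>I. b i * (x3 i * x0 i * x4 i))"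
      unfolding sum_distrib_left sum.distrib[symmetric]
      by (intro sum.cong refl) (simp add: h_def algebra_simps)
    then have h4: "(\<Sum>l\<in>I. b l * h l * x4 l) = 0" by (simp only: s024 s143 s304) simp
    have "(\<Sum>l\<in>I. b l * h l * x5 l) = \<alpha> * (\<Sum>i\<in>I. b i * (x5 i * x2 i * x0 i))
        + \<beta> * (\<Sum>i\<in>I. b i * (x1 i * x3 i * x5 i)) + \<gamma> * (\<Sum>i\<in>I. b i * (x3 i * x0 i * x5 i))"
      unfolding sum_distrib_left sum.distrib[symmetric]
      by (intro sum.cong refl) (simp add: h_def algebra_simps)
    then have h5: "(\<Sum>l\<in>I. b l * h l * x5 l) = 0" by (simp only: s520 s135 s305) simp
    have "h l = 0" if "l \<in> I - J" for l
    proof -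
      have "b l * h l = 0"
      proof (rule zero_if[of "I - J" "\<lambda>l. b l * h l"])
        show "card (I - J) \<le> 2" using J le4 by (simp add: card_Diff_subset)
        show "(\<Sum>i\<in>I - J. b i * h i * x4 i) = 0"
          using h4 hJ by (subst (asm) sum.subset_diff[OF J(1) fin]) simp
        show "(\<Sum>i\<in>I - J. b i * h i * x5 i) = 0"
          using h5 hJ by (subst (asm) sum.subset_diff[OF J(1) fin]) simp
      qed (use that in auto)
      then show ?thesis using nz that by auto
    qed
    then have "\<forall>l\<in>I. h l = 0" using hJ by blast
    then show ?thesis using z(1) unfolding h_def by blast
  qed
  then obtain \<alpha> \<beta> \<gamma> where z: "(\<alpha>, \<beta>, \<gamma>) \<noteq> (0, 0, 0)"
    and rel': "\<And>i. i \<in> I \<Longrightarrow> \<alpha> * (x0 i * x2 i) + \<beta> * (x1 i * x3 i) + \<gamma> * (x0 i * x3 i) = 0"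
    by blast
  have rel: "\<alpha> + \<beta> * r i * frob (frob (r i)) + \<gamma> * frob (frob (r i)) = 0" if "i \<in> I" for i
  proof -
    have "(\<alpha> + \<beta> * r i * frob (frob (r i)) + \<gamma> * frob (frob (r i))) * (x0 i * x2 i)
        = \<alpha> * (x0 i * x2 i) + \<beta> * (x1 i * x3 i) + \<gamma> * (x0 i * x3 i)"
      unfolding r2 unfolding r_def using nz[OF that] by (simp add: field_simps)
    then show ?thesis using nz[OF that] rel'[OF that] by simp
  qed
  obtain i j where ij: "i \<in> I" "j \<in> I" "i \<noteq> j"
  proof -
    have "\<not> card I \<le> Suc 0" using \<open>card I > 2\<close> by simp
    then show thesis using that card_le_Suc0_iff_eq[OF fin] by blast
  qed
  then have rij: "r i \<noteq> r j" using inj_r by (auto simp: inj_on_def)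
  have r_nz: "r i \<noteq> 0" if "i \<in> I" for i using nz[OF that] by (simp add: r_def)
  \<comment> \<open>Without \<open>\<alpha>\<close>, or without \<open>\<beta>\<close>, the relation
    would be trivial or force all \<open>r i\<close> to coincide.\<close>
  have "\<alpha> \<noteq> 0"
  proof
    assume "\<alpha> = 0"
    then have "\<beta> * r i + \<gamma> = 0" "\<beta> * r j + \<gamma> = 0"
      using rel[OF ij(1)] rel[OF ij(2)] r_nz ij by (auto simp: ring_distribs(2)[symmetric])
    moreover have "\<beta> * (r i - r j) = (\<beta> * r i + \<gamma>) - (\<beta> * r j + \<gamma>)" by (simp add: algebra_simps)
    ultimately have "\<beta> * (r i - r j) = 0" by simp
    then show False using rij z \<open>\<alpha> = 0\<close> \<open>\<beta> * r i + \<gamma> = 0\<close> by auto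
  qed
  have "\<beta> \<noteq> 0"
  proof
    assume "\<beta> = 0"
    then have "\<alpha> + \<gamma> * frob (frob (r i)) = 0" "\<alpha> + \<gamma> * frob (frob (r j)) = 0"
      using rel[OF ij(1)] rel[OF ij(2)] by auto
    moreover have "\<gamma> * (frob (frob (r i)) - frob (frob (r j)))
        = (\<alpha> + \<gamma> * frob (frob (r i))) - (\<alpha> + \<gamma> * frob (frob (r j)))" by (simp add: algebra_simps)
    ultimately have "\<gamma> * (frob (frob (r i)) - frob (frob (r j))) = 0" by simp
    then have "\<gamma> = 0" using rij by simp
    then show False using \<open>\<alpha> \<noteq> 0\<close> \<open>\<alpha> + \<gamma> * frob (frob (r i)) = 0\<close> by simp
  qed
  define \<alpha>4 where "\<alpha>4 = frob (frob (frob (frob \<alpha>)))"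
  define \<gamma>2 where "\<gamma>2 = frob (frob \<gamma>)"
  define \<beta>2 where "\<beta>2 = frob (frob \<beta>)"
  define p1 where "p1 = \<alpha>4 * \<gamma>2 * \<beta> + frob (frob \<gamma>2) * \<gamma>2 * \<gamma> - frob (frob \<gamma>2) * \<alpha> * \<beta>2 - frob (frob \<beta>2) * frob (frob \<alpha>) * \<gamma>"
  define p where "p = [:\<alpha>4 * (\<gamma>2 * \<gamma> - \<alpha> * \<beta>2), p1, frob (frob \<gamma>2) * \<gamma>2 * \<beta> - frob (frob \<beta>2) * frob (frob \<alpha>) * \<beta>:]"
  have "p = 0"
  proof (rule ccontr)
    assume "p \<noteq> 0"
    have "poly p (r i) = 0" if "i \<in> I" for i
    proof -
      have "r i \<in> K6" using x6[OF that] by (simp add: K6_def r_def xsym)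
      from frob_frob_eq_quadratic[OF rel[OF that] this refl refl refl refl refl refl]
      show ?thesis by (simp add: p_def p1_def \<alpha>4_def \<gamma>2_def \<beta>2_def algebra_simps power2_eq_square)
    qed
    then have "r ` I \<subseteq> {x. poly p x = 0}" by auto
    then have "card (r ` I) \<le> card {x. poly p x = 0}"
      using poly_roots_finite[OF \<open>p \<noteq> 0\<close>] card_mono by blast
    also have "\<dots> \<le> Polynomial.degree p" using card_poly_roots_bound[OF \<open>p \<noteq> 0\<close>] .
    also have "\<dots> \<le> 2" by (simp add: p_def)
    finally show False using \<open>card I > 2\<close> by (simp add: card_image inj_r)
  qed
  \<comment> \<open>The constant coefficient yields the identity \<open>g2\<close>, which turns the
    transform after rescaling into \<rho> -> -1/(1+\<rho>), a map of order three.\<close>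
  then have "\<alpha>4 * (\<gamma>2 * \<gamma> - \<alpha> * \<beta>2) = 0" by (simp add: p_def)
  then have g2: "\<gamma>2 * \<gamma> = \<alpha> * \<beta>2" using \<open>\<alpha> \<noteq> 0\<close> by (simp add: \<alpha>4_def)
  have "\<gamma> \<noteq> 0" using g2 \<open>\<alpha> \<noteq> 0\<close> \<open>\<beta> \<noteq> 0\<close> by (auto simp: \<beta>2_def)
  define \<rho> where "\<rho> i = \<beta> * r i / \<gamma>" for i
  have rel\<rho>: "frob (frob (\<rho> i)) * (1 + \<rho> i) = - 1" if "i \<in> I" for i
  proof -
    have "frob (frob (\<rho> i)) * (1 + \<rho> i) = \<beta>2 / (\<gamma>2 * \<gamma>) * (\<beta> * r i * frob (frob (r i)) + \<gamma> * frob (frob (r i)))"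
      using \<open>\<gamma> \<noteq> 0\<close> by (simp add: \<rho>_def \<beta>2_def \<gamma>2_def field_simps)
    also have "\<dots> = \<beta>2 / (\<gamma>2 * \<gamma>) * (- \<alpha>)"
      using rel[OF that] by (simp only: add.assoc add_eq_0_iff)
    also have "\<dots> = - 1" using g2 \<open>\<alpha> \<noteq> 0\<close> \<open>\<beta> \<noteq> 0\<close> by (simp add: \<beta>2_def)
    finally show ?thesis .
  qed
  have \<rho>_nz: "\<rho> i \<noteq> 0" "1 + \<rho> i \<noteq> 0" if "i \<in> I" for i
    using r_nz[OF that] rel\<rho>[OF that] \<open>\<beta> \<noteq> 0\<close> \<open>\<gamma> \<noteq> 0\<close> by (auto simp: \<rho>_def)
  have \<rho>2: "frob (frob (\<rho> i)) = - 1 / (1 + \<rho> i)" if "i \<in> I" for i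
    using nonzero_eq_divide_eq[OF \<rho>_nz(2)[OF that], of "frob (frob (\<rho> i))" "- 1"] rel\<rho>[OF that] by blast
  have \<rho>4: "frob (frob (frob (frob (\<rho> i)))) = - (1 + \<rho> i) / \<rho> i" if "i \<in> I" for i
  proof -
    have "frob (frob (frob (frob (\<rho> i)))) * (1 + frob (frob (\<rho> i))) = - 1"
      using arg_cong[OF rel\<rho>[OF that], of "\<lambda>x. frob (frob x)"] by simp
    moreover have "1 + frob (frob (\<rho> i)) = \<rho> i / (1 + \<rho> i)"
      using \<rho>2[OF that] \<rho>_nz[OF that] by (simp add: field_simps)
    ultimately show ?thesis using \<rho>_nz[OF that] by (simp add: field_simps)
  qed
  \<comment> \<open>Multiplying x_0 x_2 x_4 by r, r_2 or r_4 replaces one conjugate by its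
    successor, which leads to the monomials of \<open>s142\<close>, \<open>s304\<close> and
    \<open>s520\<close>.\<close>
  define w where "w i = b i * (x0 i * x2 i * x4 i)" for i
  have w0: "(\<Sum>i\<in>I. w i) = 0" using s024 by (simp add: w_def)
  have w1: "(\<Sum>i\<in>I. w i * \<rho> i) = 0"
  proof -
    have "(\<Sum>i\<in>I. w i * \<rho> i) = \<beta> / \<gamma> * (\<Sum>i\<in>I. b i * (x1 i * x4 i * x2 i))"
      unfolding sum_distrib_left
      by (intro sum.cong refl) (use nz in \<open>simp add: w_def \<rho>_def r_def field_simps\<close>)
    then show ?thesis by (simp only: s142) simp
  qed
  have w2: "(\<Sum>i\<in>I. w i / (1 + \<rho> i)) = 0"
  proof -
    have "(\<Sum>i\<in>I. w i / (1 + \<rho> i)) = (\<Sum>i\<in>I. - (w i * frob (frob (\<rho> i))))"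
      by (intro sum.cong refl) (simp add: \<rho>2)
    also have "\<dots> = - (\<beta>2 / \<gamma>2) * (\<Sum>i\<in>I. b i * (x3 i * x0 i * x4 i))"
      unfolding sum_distrib_left
      by (intro sum.cong refl) (use nz \<open>\<gamma> \<noteq> 0\<close> in \<open>simp add: w_def \<rho>_def r2 \<beta>2_def \<gamma>2_def field_simps\<close>)
    finally show ?thesis by (simp only: s304) simp
  qed
  have w4: "(\<Sum>i\<in>I. w i / \<rho> i) = 0"
  proof -
    have "(\<Sum>i\<in>I. w i / \<rho> i) = (\<Sum>i\<in>I. - (w i * frob (frob (frob (frob (\<rho> i))))) - w i)"
      by (intro sum.cong refl) (use \<rho>_nz in \<open>simp add: \<rho>4 field_simps\<close>)
    also have "\<dots> = (\<Sum>i\<in>I. - (w i * frob (frob (frob (frob (\<rho> i))))))"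
      by (simp add: sum_subtractf w0)
    also have "\<dots> = - (frob (frob \<beta>2) / frob (frob \<gamma>2)) * (\<Sum>i\<in>I. b i * (x5 i * x2 i * x0 i))"
      unfolding sum_distrib_left
      by (intro sum.cong refl) (use nz \<open>\<gamma> \<noteq> 0\<close> in \<open>simp add: w_def \<rho>_def r4 \<beta>2_def \<gamma>2_def field_simps\<close>)
    finally show ?thesis by (simp only: s520) simp
  qed
  \<comment> \<open>Partial fractions: 1, \<rho>, 1/(1+\<rho>) and 1/\<rho> span the cubic
    polynomials in \<rho> divided by \<rho>(1+\<rho>). Hence the weights
    \<open>w i / (\<rho> i * (1 + \<rho> i))\<close> have vanishing power sums for the exponents 0
    to 3, enough for four points.\<close>
  have pf: "w / (u * v) = w / u - w / v" "w / (u * v) * u = w / v"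
      "w / (u * v) * u\<^sup>2 = w - w / v" "w / (u * v) * u ^ 3 = w * u - w + w / v"
    if "u \<noteq> 0" "v \<noteq> 0" "v = 1 + u" for w u v :: 'b
    using that(1,2)
    by (simp_all add: divide_simps) (simp_all add: that(3) algebra_simps power2_eq_square power3_eq_cube)
  have w': "w i / (\<rho> i * (1 + \<rho> i)) = 0" if "i \<in> I" for i
  proof (rule weighted_power_sums_zero_imp_zero[OF fin, of \<rho> "\<lambda>i. w i / (\<rho> i * (1 + \<rho> i))"])
    show "inj_on \<rho> I" using inj_r \<open>\<beta> \<noteq> 0\<close> \<open>\<gamma> \<noteq> 0\<close> by (auto simp: inj_on_def \<rho>_def)
    fix k assume "k < card I"
    then have "k = 0 \<or> k = 1 \<or> k = 2 \<or> k = 3" using le4 by linarith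
    moreover have t0: "(\<Sum>i\<in>I. w i / (\<rho> i * (1 + \<rho> i))) = (\<Sum>i\<in>I. w i / \<rho> i - w i / (1 + \<rho> i))"
      by (intro sum.cong refl) (use pf(1)[OF \<rho>_nz refl] in simp)
    moreover have t1: "(\<Sum>i\<in>I. w i / (\<rho> i * (1 + \<rho> i)) * \<rho> i) = (\<Sum>i\<in>I. w i / (1 + \<rho> i))"
      by (intro sum.cong refl) (use pf(2)[OF \<rho>_nz refl] in simp)
    moreover have t2: "(\<Sum>i\<in>I. w i / (\<rho> i * (1 + \<rho> i)) * \<rho> i ^ 2) = (\<Sum>i\<in>I. w i - w i / (1 + \<rho> i))"
      by (intro sum.cong refl) (use pf(3)[OF \<rho>_nz refl] in simp)
    moreover have t3: "(\<Sum>i\<in>I. w i / (\<rho> i * (1 + \<rho> i)) * \<rho> i ^ 3) = (\<Sum>i\<in>I. w i * \<rho> i - w i + w i / (1 + \<rho> i))"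
      by (intro sum.cong refl) (use pf(4)[OF \<rho>_nz refl] in simp)
    ultimately show "(\<Sum>i\<in>I. w i / (\<rho> i * (1 + \<rho> i)) * \<rho> i ^ k) = 0"
      by (auto simp: sum_subtractf sum.distrib w0 w1 w2 w4)
  qed (use that in auto)
  show False using w'[OF ij(1)] \<rho>_nz[OF ij(1)] nz[OF ij(1)] by (simp add: w_def)
qed

end

section \<open>Five dependent points\<close>

lemma eq_or_eq_if_sum_prod_eq:
  fixes a b c d :: "'b::field"
  assumes "a + b = c + d" "a * b = c * d"
  shows "a = c \<or> a = d"
proof -
  have "(a - c) * (a - d) = a * (a + b) - a * (c + d) + c * d - a * b" by (simp add: algebra_simps)
  then have "(a - c) * (a - d) = 0" using assms by simp
  then show ?thesis by auto
qed

text \<open>The Markov relation for traces of a product equal to one: with c = r + 1/r it reads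
  c0^2 + c1^2 + c2^2 - c0 c1 c2 = 4.\<close>

lemma markov_relation:
  fixes r0 r1 r2 :: "'b::field"
  assumes "r0 * r1 * r2 = 1"
    and S: "S0 = r0 + 1 / r0 - 2" "S1 = r1 + 1 / r1 - 2" "S2 = r2 + 1 / r2 - 2"
  shows "(S0 + S1 + S2)\<^sup>2 - 4 * (S0 * S1 + S1 * S2 + S2 * S0) = S0 * S1 * S2"
proof -
  have nz: "r0 \<noteq> 0" "r1 \<noteq> 0" "r2 \<noteq> 0" using assms(1) by auto
  then have r2: "r2 = 1 / (r0 * r1)" using assms(1) by (simp add: field_simps)
  show ?thesis
    using nz(1,2) unfolding S r2 by (simp add: field_simps power2_eq_square power3_eq_cube)
qed

text \<open>The left-hand side is the resultant of the quadratics with roots t_0 t_2 + s_0 s_2,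
  t_0 s_2 + s_0 t_2 and Z t_1 + Z' s_1, Z s_1 + Z' t_1, respectively, where t_i + s_i = c_i,
  Z + Z' = la and all the products t_i s_i and Z Z' equal mu.\<close>

lemma resultant_identity:
  fixes S0 S1 S2 la mu :: "'b::field"
  assumes c: "c0 = la + S0" "c1 = la + S1" "c2 = la + S2"
    and E: "E1 = S0 + S1 + S2" "E2 = S0 * S1 + S1 * S2 + S2 * S0" "N = S0 * S1 * S2" "K = E1\<^sup>2 - 4 * E2"
  shows "(mu * (la\<^sup>2 + c1\<^sup>2 - 4 * mu) - mu * (c0\<^sup>2 + c2\<^sup>2 - 4 * mu))\<^sup>2
      - (la * c1 - c0 * c2) * (c0 * c2 * (mu * (la\<^sup>2 + c1\<^sup>2 - 4 * mu)) - la * c1 * (mu * (c0\<^sup>2 + c2\<^sup>2 - 4 * mu)))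
    = mu * (mu * (4 * la + E1) * (E1 * K + 8 * N)
      - (la ^ 3 * (8 * N + E1 * K) + la\<^sup>2 * (2 * E1 * N + E2 * K) + la * N * K - N\<^sup>2))"
  unfolding c E by (simp add: algebra_simps power2_eq_square power3_eq_cube)


text \<open>In terms of c_i = r_i + 1/r_i the left-hand side is 4 + c_0 c_1 + c_1 c_2 + c_2 c_0. The
  factorization is what excludes l = 0 later on.\<close>

lemma markov_second_symmetric:
  fixes r0 r1 r2 :: "'b::field"
  assumes "r0 * r1 * r2 = 1"
    and S: "S0 = r0 + 1 / r0 - 2" "S1 = r1 + 1 / r1 - 2" "S2 = r2 + 1 / r2 - 2"
  shows "4 * (S0 + S1 + S2) + 16 + (S0 * S1 + S1 * S2 + S2 * S0) =
    (1 + (r0 + r1 + r2)) * (1 + (1 / r0 + 1 / r1 + 1 / r2))"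
proof -
  have nz: "r0 \<noteq> 0" "r1 \<noteq> 0" "r2 \<noteq> 0" using assms(1) by auto
  then have r2: "r2 = 1 / (r0 * r1)" using assms(1) by (simp add: field_simps)
  show ?thesis
    using nz(1,2) unfolding S r2 by (simp add: field_simps power2_eq_square power3_eq_cube)
qed

text \<open>For three conjugates the right-hand side is the norm of 1 + \<rho>; this makes the
  denominator in the formula for l nonzero.\<close>

lemma norm_one_plus:
  fixes r0 r1 r2 :: "'b::field"
  assumes "r0 * r1 * r2 = 1"
  shows "2 + (r0 + r1 + r2) + (1 / r0 + 1 / r1 + 1 / r2) = (1 + r0) * (1 + r1) * (1 + r2)"
proof -
  have nz: "r0 \<noteq> 0" "r1 \<noteq> 0" "r2 \<noteq> 0" using assms by auto
  then have r2: "r2 = 1 / (r0 * r1)" using assms by (simp add: field_simps)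
  show ?thesis using nz(1,2) unfolding r2 by (simp add: field_simps)
qed

text \<open>Passes from coefficients to roots: when the left-hand side vanishes, one of
  \<open>w\<close>, \<open>w'\<close> equals one of \<open>v\<close>, \<open>v'\<close>.\<close>

lemma resultant_of_quadratics:
  fixes w w' v v' :: "'b::field"
  assumes "a1 = w + w'" "b1 = w * w'" "a2 = v + v'" "b2 = v * v'"
  shows "(b2 - b1)\<^sup>2 - (a2 - a1) * (a1 * b2 - a2 * b1) = (w - v) * (w - v') * (w' - v) * (w' - v')"
  unfolding assms by (simp add: algebra_simps power2_eq_square)

text \<open>As polynomials in l, the two sides differ by l^2 times a linear polynomial, since the
  coefficients of 1 and l agree when M = E1 + 8. The second hypothesis says that l is a root of the
  linear factor.\<close>

lemma quadratic_parameter_relation: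
  fixes l cc E1 E2 M :: "'b::field"
  assumes "M = E1 + 8" and l: "l * (M * (4 * cc - 1)) = 4 * E1 + 16 + E2 - cc * M\<^sup>2"
  shows "(1 + l + l\<^sup>2 * cc) * (4 * (l + 2) + E1) * M =
    M * (l + 2) ^ 3 + (2 * E1 + E2) * (l + 2)\<^sup>2 + (E1\<^sup>2 - 4 * E2) * (l + 2) - (E1\<^sup>2 - 4 * E2)"
proof -
  have "cc * M * (4 * l + M) = l * (M * (4 * cc - 1)) + cc * M\<^sup>2 + l * M"
    by (simp add: algebra_simps power2_eq_square)
  also have "\<dots> = l * M + (4 * E1 + 16 + E2)" by (simp add: l)
  finally have cc: "cc * M * (4 * l + M) = l * M + (4 * E1 + 16 + E2)" .
  have "(1 + l + l\<^sup>2 * cc) * (4 * (l + 2) + E1) * M = (1 + l) * M * (4 * l + M) + l\<^sup>2 * (cc * M * (4 * l + M))"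
    by (simp add: assms(1) algebra_simps)
  also have "\<dots> = M * (l + 2) ^ 3 + (2 * E1 + E2) * (l + 2)\<^sup>2 + (E1\<^sup>2 - 4 * E2) * (l + 2) - (E1\<^sup>2 - 4 * E2)"
    unfolding cc unfolding assms(1) by (simp add: algebra_simps power2_eq_square power3_eq_cube)
  finally show ?thesis .
qed

section \<open>Construction of the conjugate pair t, t_3\<close>

context field_endomorphism
begin

text \<open>Equality would force \<open>frob \<rho>\<close> to be \<open>1 / \<rho>\<close>, but
  inversion is an involution whereas \<open>frob\<close> acts on \<rho> with order three.\<close>

lemma frob_plus_inverse_neq:
  assumes "frob (frob (frob \<rho>)) = \<rho>" "frob \<rho> \<noteq> \<rho>" "frob l = l"
  shows "frob (l + \<rho> + 1 / \<rho>) \<noteq> l + \<rho> + 1 / \<rho>"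
proof
  have nz: "\<rho> \<noteq> 0" using assms(2) by auto
  assume "frob (l + \<rho> + 1 / \<rho>) = l + \<rho> + 1 / \<rho>"
  then have "frob \<rho> + 1 / frob \<rho> = \<rho> + 1 / \<rho>" by (simp add: assms(3))
  then have "frob \<rho> = \<rho> \<or> frob \<rho> = 1 / \<rho>"
    by (rule eq_or_eq_if_sum_prod_eq) (use nz in simp)
  with assms(2) have "frob \<rho> = 1 / \<rho>" by simp
  then have "frob (frob \<rho>) = \<rho>" by simp
  with assms(1) have "frob \<rho> = \<rho>" by simp
  with assms(2) show False by simp
qed

text \<open>The resultant vanishes by the choice of l. Hence t_0 t_2, up to replacing t_2 by its
  conjugate s_2, is the product of Z or Z' and one of t_1, s_1; only the cases t_0 t_2 = Z t_1
  and t_0 t_2 = Z' t_1 are compatible with the action of frob.\<close>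

lemma conjugate_pair_exists:
  assumes \<rho>: "frob (frob (frob \<rho>)) = \<rho>" "\<rho> * frob \<rho> * frob (frob \<rho>) = 1" "frob \<rho> \<noteq> \<rho>"
    and \<eta>: "frob (frob \<eta>) = \<eta>" "\<eta> + frob \<eta> = 1" "frob \<eta> \<noteq> \<eta>"
    and root: "\<And>b c. \<exists>t. t * t - b * t + c = (0 :: 'b)"
  obtains l \<mu> t where "frob l = l" "frob \<mu> = \<mu>" "\<mu> \<noteq> 0" "t \<in> K6"
    "frob (frob (frob t)) \<noteq> t" "t * frob (frob (frob t)) = \<mu>"
    "t + frob (frob (frob t)) = l + \<rho> + 1 / \<rho>"
    "t * frob (frob t) * frob (frob (frob (frob t)))
      + frob t * frob (frob (frob t)) * frob (frob (frob (frob (frob t)))) = \<mu> * (l + 2)"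
proof -
  define r1 where "r1 = frob \<rho>"
  define r2 where "r2 = frob r1"
  have fr2: "frob r2 = \<rho>" using \<rho>(1) by (simp add: r1_def r2_def)
  have r_prod: "\<rho> * r1 * r2 = 1" using \<rho>(2) by (simp add: r1_def r2_def)
  have nz: "\<rho> \<noteq> 0" "r1 \<noteq> 0" "r2 \<noteq> 0" using r_prod by auto
  define p where "p = \<rho> + r1 + r2"
  define p' where "p' = 1 / \<rho> + 1 / r1 + 1 / r2"
  have fp: "frob p = p" "frob p' = p'"
    by (simp_all add: p_def p'_def fr2 add_ac flip: r1_def r2_def)
  define M where "M = 2 + p + p'"
  have M_prod: "M = (1 + \<rho>) * (1 + r1) * (1 + r2)"
    unfolding M_def p_def p'_def by (rule norm_one_plus[OF r_prod])
  have "1 + \<rho> \<noteq> 0" using \<rho>(3) by (auto simp: add_eq_0_iff)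
  moreover from this have "frob (1 + \<rho>) \<noteq> 0" "frob (frob (1 + \<rho>)) \<noteq> 0" by (simp_all only: frob_eq_0_iff not_False_eq_True)
  ultimately have "M \<noteq> 0" by (simp add: M_prod r1_def r2_def)
  have fM: "frob M = M" by (simp add: M_def fp)
  define cc where "cc = \<eta> * frob \<eta>"
  have fcc: "frob cc = cc" by (simp add: cc_def \<eta>(1) mult.commute)
  \<comment> \<open>\<open>1 - 4 * cc\<close> is the discriminant of the quadratic with roots \<eta>
    and its conjugate, hence nonzero in every characteristic.\<close>
  have "(\<eta> - frob \<eta>)\<^sup>2 = (\<eta> + frob \<eta>)\<^sup>2 - 4 * cc" by (simp add: cc_def algebra_simps power2_eq_square)
  then have "4 * cc - 1 = - ((\<eta> - frob \<eta>)\<^sup>2)" by (simp add: \<eta>(2))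
  then have cc1: "4 * cc - 1 \<noteq> 0" using \<eta>(3) by simp
  \<comment> \<open>The root of the linear factor in \<open>quadratic_parameter_relation\<close>,
    with \<open>4 * E1 + 16 + E2\<close> in factored form.\<close>
  define l where "l = ((1 + p) * (1 + p') - cc * M\<^sup>2) / (M * (4 * cc - 1))"
  have fl: "frob l = l" by (simp add: l_def fp fM fcc)
  have l_eq: "l * (M * (4 * cc - 1)) = (1 + p) * (1 + p') - cc * M\<^sup>2"
    using \<open>M \<noteq> 0\<close> cc1 by (simp add: l_def)
  \<comment> \<open>For l = 0 the norm of \<eta> would be y(1 - y) with y in F_q, so \<eta> itself
    would be y or 1 - y. Nonzero l keeps Z outside F_q.\<close>
  have l_nz: "l \<noteq> 0"
  proof
    assume "l = 0"
    define y where "y = (1 + p) / M"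
    have y1: "1 - y = (1 + p') / M" using \<open>M \<noteq> 0\<close> by (simp add: y_def M_def field_simps)
    have "cc * (M * M) = (1 + p) * (1 + p')"
      using l_eq \<open>l = 0\<close> by (simp add: power2_eq_square)
    then have "cc = (1 + p) * (1 + p') / (M * M)" using \<open>M \<noteq> 0\<close> by (subst nonzero_eq_divide_eq) auto
    then have "cc = y * (1 - y)" unfolding y1 by (simp add: y_def)
    moreover have "\<eta> + frob \<eta> = y + (1 - y)" by (simp add: \<eta>(2))
    ultimately have "\<eta> = y \<or> \<eta> = 1 - y"
      unfolding cc_def by (intro eq_or_eq_if_sum_prod_eq)
    moreover have "frob y = y" by (simp add: y_def fp fM)
    ultimately have "frob \<eta> = \<eta>" by auto
    with \<eta>(3) show False by simp
  qed
  define Z where "Z = 1 + l * \<eta>"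
  define Z' where "Z' = 1 + l * frob \<eta>"
  have fZ: "frob Z = Z'" "frob Z' = Z" by (simp_all add: Z_def Z'_def fl \<eta>(1))
  have ZZ': "Z \<noteq> Z'" using l_nz \<eta>(3) by (auto simp: Z_def Z'_def)
  define \<mu> where "\<mu> = 1 + l + l\<^sup>2 * cc"
  have f\<mu>: "frob \<mu> = \<mu>" by (simp add: \<mu>_def fl fcc)
  have Z_prod: "Z * Z' = \<mu>"
  proof -
    have "Z * Z' = 1 + l * (\<eta> + frob \<eta>) + l\<^sup>2 * cc"
      by (simp add: Z_def Z'_def cc_def algebra_simps power2_eq_square)
    then show ?thesis by (simp add: \<eta>(2) \<mu>_def)
  qed
  define la where "la = l + 2"
  have Z_sum: "Z + Z' = la"
  proof -
    have "Z + Z' = 2 + l * (\<eta> + frob \<eta>)" by (simp add: Z_def Z'_def algebra_simps)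
    then show ?thesis by (simp add: \<eta>(2) la_def)
  qed
  have Z_nz: "Z \<noteq> 0"
  proof
    assume "Z = 0"
    then have "Z' = 0" using fZ(1) by simp
    with \<open>Z = 0\<close> ZZ' show False by simp
  qed
  then have Z'_nz: "Z' \<noteq> 0" using fZ(1) by (metis frob_eq_0_iff)
  have \<mu>_nz: "\<mu> \<noteq> 0" using Z_nz Z'_nz Z_prod by auto
  define S0 where "S0 = \<rho> + 1 / \<rho> - 2"
  define S1 where "S1 = r1 + 1 / r1 - 2"
  define S2 where "S2 = r2 + 1 / r2 - 2"
  define E1 where "E1 = S0 + S1 + S2"
  define E2 where "E2 = S0 * S1 + S1 * S2 + S2 * S0"
  define N where "N = S0 * S1 * S2"
  have K: "E1\<^sup>2 - 4 * E2 = N"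
    unfolding E1_def E2_def N_def by (rule markov_relation[OF r_prod S0_def S1_def S2_def])
  have ME: "M = E1 + 8" by (simp add: M_def E1_def S0_def S1_def S2_def p_def p'_def)
  have "4 * E1 + 16 + E2 = (1 + p) * (1 + p')"
    unfolding E1_def E2_def p_def p'_def by (rule markov_second_symmetric[OF r_prod S0_def S1_def S2_def])
  then have "l * (M * (4 * cc - 1)) = 4 * E1 + 16 + E2 - cc * M\<^sup>2" using l_eq by simp
  from quadratic_parameter_relation[OF ME this]
  have H: "\<mu> * (4 * la + E1) * M = M * la ^ 3 + (2 * E1 + E2) * la\<^sup>2 + N * la - N"
    by (simp add: \<mu>_def la_def K)
  define c0 where "c0 = la + S0"
  define c1 where "c1 = la + S1"
  define c2 where "c2 = la + S2"
  have c0_eq: "c0 = l + \<rho> + 1 / \<rho>" by (simp add: c0_def la_def S0_def)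
  have fc: "frob c0 = c1" "frob c1 = c2" "frob c2 = c0"
    by (simp_all add: c0_def c1_def c2_def S0_def S1_def S2_def la_def fl fr2 flip: r1_def r2_def)
  \<comment> \<open>By \<open>markov_relation\<close> the quantity \<open>K\<close> of
    \<open>resultant_identity\<close> equals \<open>N\<close>. The bracket there is then a multiple
    of \<open>N\<close>, and the cofactor vanishes by \<open>H\<close>.\<close>
  have "\<mu> * (4 * la + E1) * (E1 * N + 8 * N)
      - (la ^ 3 * (8 * N + E1 * N) + la\<^sup>2 * (2 * E1 * N + E2 * N) + la * N * N - N\<^sup>2)
    = N * (\<mu> * (4 * la + E1) * M - (M * la ^ 3 + (2 * E1 + E2) * la\<^sup>2 + N * la - N))"
    by (simp add: ME algebra_simps power2_eq_square)
  also have "\<dots> = 0" by (simp only: H) simp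
  finally have R0: "\<mu> * (4 * la + E1) * (E1 * N + 8 * N)
      - (la ^ 3 * (8 * N + E1 * N) + la\<^sup>2 * (2 * E1 * N + E2 * N) + la * N * N - N\<^sup>2) = 0" .
  have res: "(\<mu> * (la\<^sup>2 + c1\<^sup>2 - 4 * \<mu>) - \<mu> * (c0\<^sup>2 + c2\<^sup>2 - 4 * \<mu>))\<^sup>2
      - (la * c1 - c0 * c2) * (c0 * c2 * (\<mu> * (la\<^sup>2 + c1\<^sup>2 - 4 * \<mu>)) - la * c1 * (\<mu> * (c0\<^sup>2 + c2\<^sup>2 - 4 * \<mu>))) = 0"
    by (subst resultant_identity[OF c0_def c1_def c2_def E1_def E2_def N_def K[symmetric]])
      (simp only: R0 mult_zero_right)
  obtain t where t: "t * t - c0 * t + \<mu> = 0" using root by blast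
  define s where "s = c0 - t"
  have ts: "t + s = c0" "t * s = \<mu>" using t by (simp_all add: s_def algebra_simps)
  define t1 where "t1 = frob t"
  define t2 where "t2 = frob t1"
  define s1 where "s1 = frob s"
  define s2 where "s2 = frob s1"
  have ts1: "t1 + s1 = c1" "t1 * s1 = \<mu>"
    using arg_cong[OF ts(1), of frob] arg_cong[OF ts(2), of frob] by (simp_all add: t1_def s1_def fc f\<mu>)
  have ts2: "t2 + s2 = c2" "t2 * s2 = \<mu>"
    using arg_cong[OF ts1(1), of frob] arg_cong[OF ts1(2), of frob] by (simp_all add: t2_def s2_def fc f\<mu>)
  have cross_sum: "(a * c + b * d) + (a * d + b * c) = (a + b) * (c + d)"
    and cross_prod: "(a * c + b * d) * (a * d + b * c) = m * ((a + b)\<^sup>2 + (c + d)\<^sup>2 - 4 * m)"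
    if "a * b = m" "c * d = m" for a b c d m :: 'b
  proof -
    show "(a * c + b * d) + (a * d + b * c) = (a + b) * (c + d)" by (simp add: algebra_simps)
    have "(a * c + b * d) * (a * d + b * c) = (c * d) * ((a + b)\<^sup>2 - 2 * (a * b)) + (a * b) * ((c + d)\<^sup>2 - 2 * (c * d))"
      by (simp add: algebra_simps power2_eq_square)
    then show "(a * c + b * d) * (a * d + b * c) = m * ((a + b)\<^sup>2 + (c + d)\<^sup>2 - 4 * m)"
      unfolding that by (simp add: algebra_simps)
  qed
  define w where "w = t * t2 + s * s2"
  define w' where "w' = t * s2 + s * t2"
  define v where "v = Z * t1 + Z' * s1"
  define v' where "v' = Z * s1 + Z' * t1"
  have "(w - v) * (w - v') * (w' - v) * (w' - v') = 0"
  proof (subst resultant_of_quadratics[symmetric, of "c0 * c2" _ _ "\<mu> * (c0\<^sup>2 + c2\<^sup>2 - 4 * \<mu>)" "la * c1" _ _ "\<mu> * (la\<^sup>2 + c1\<^sup>2 - 4 * \<mu>)"])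
    show "c0 * c2 = w + w'"
      using cross_sum[OF ts(2) ts2(2)] by (simp add: w_def w'_def ts ts2)
    show "\<mu> * (c0\<^sup>2 + c2\<^sup>2 - 4 * \<mu>) = w * w'"
      using cross_prod[OF ts(2) ts2(2)] by (simp add: w_def w'_def ts ts2)
    show "la * c1 = v + v'"
      using cross_sum[OF Z_prod ts1(2)] by (simp add: v_def v'_def Z_sum ts1)
    show "\<mu> * (la\<^sup>2 + c1\<^sup>2 - 4 * \<mu>) = v * v'"
      using cross_prod[OF Z_prod ts1(2)] by (simp add: v_def v'_def Z_sum ts1)
  qed (rule res)
  then have vw: "w = v \<or> w = v' \<or> w' = v \<or> w' = v'" by auto
  \<comment> \<open>The two summands of each of \<open>w\<close>, \<open>w'\<close>,
    \<open>v\<close>, \<open>v'\<close> have the product \<open>\<mu> * \<mu>\<close>, so equal sums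
    have the same summands.\<close>
  have pr: "(t * t2) * (s * s2) = \<mu> * \<mu>" "(t * s2) * (s * t2) = \<mu> * \<mu>"
    "(Z * t1) * (Z' * s1) = \<mu> * \<mu>" "(Z * s1) * (Z' * t1) = \<mu> * \<mu>"
    using ts(2) ts2(2) ts1(2) Z_prod by (metis mult.assoc mult.left_commute mult.commute)+
  have "t * t2 = Z * t1 \<or> t * t2 = Z' * s1" if "w = v"
    using that pr(1,3) by (intro eq_or_eq_if_sum_prod_eq[of _ "s * s2"]) (simp_all add: w_def v_def)
  moreover have "t * t2 = Z * s1 \<or> t * t2 = Z' * t1" if "w = v'"
    using that pr(1,4) by (intro eq_or_eq_if_sum_prod_eq[of _ "s * s2"]) (simp_all add: w_def v'_def)
  moreover have "t * s2 = Z * t1 \<or> t * s2 = Z' * s1" if "w' = v"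
    using that pr(2,3) by (intro eq_or_eq_if_sum_prod_eq[of _ "s * t2"]) (simp_all add: w'_def v_def)
  moreover have "t * s2 = Z * s1 \<or> t * s2 = Z' * t1" if "w' = v'"
    using that pr(2,4) by (intro eq_or_eq_if_sum_prod_eq[of _ "s * t2"]) (simp_all add: w'_def v'_def)
  ultimately have alt: "(\<exists>Y B. (Y = Z \<or> Y = Z') \<and> (B = t1 \<or> B = s1) \<and> t * t2 = Y * B)
      \<or> (\<exists>Y B. (Y = Z \<or> Y = Z') \<and> (B = t1 \<or> B = s1) \<and> t * s2 = Y * B)"
    using vw by blast
  have f3c: "frob (frob (frob c0)) = c0" by (simp add: fc)
  have "(frob (frob (frob t)) - t) * (frob (frob (frob t)) - s)
      = frob (frob (frob (t * t - c0 * t + \<mu>))) + (t * s - \<mu>) + frob (frob (frob t)) * (c0 - (t + s))"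
    by (simp add: f3c f\<mu> algebra_simps)
  then have "frob (frob (frob t)) = t \<or> frob (frob (frob t)) = s" by (simp add: ts t)
  \<comment> \<open>If t were in F_(q^3), so would be s and all their conjugates, and
    \<open>alt\<close> would put Z or Z' into F_(q^3). But three applications of \<open>frob\<close>
    interchange Z and Z'.\<close>
  moreover have "frob (frob (frob t)) \<noteq> t"
  proof
    assume t3: "frob (frob (frob t)) = t"
    then have s3: "frob (frob (frob s)) = s" by (simp add: s_def f3c)
    have f3: "frob (frob (frob x)) = x" if "x \<in> {t, s, t1, s1, t2, s2}" for x
      using that by (auto simp: t1_def t2_def s1_def s2_def t3 s3)
    obtain A Y B where AYB: "A = Y * B" "Y = Z \<or> Y = Z'" "B = t1 \<or> B = s1"
      "frob (frob (frob A)) = A"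
    proof -
      have "frob (frob (frob (t * t2))) = t * t2" "frob (frob (frob (t * s2))) = t * s2"
        using f3[of t] f3[of t2] f3[of s2] by simp_all
      then show thesis using alt that by blast
    qed
    have "B \<noteq> 0" using AYB(3) ts1(2) \<mu>_nz by auto
    have "frob (frob (frob B)) = B" using AYB(3) f3 by auto
    with AYB(1,4) \<open>B \<noteq> 0\<close> have "frob (frob (frob Y)) = Y" by simp
    then show False using AYB(2) fZ ZZ' by auto
  qed
  ultimately have t3: "frob (frob (frob t)) = s" by simp
  then have s3: "frob (frob (frob s)) = t" by (simp add: s_def f3c)
  have "t \<in> K6" by (simp add: K6_def t3 s3)
  have t4: "frob s = s1" "frob s1 = s2" "frob s2 = t" "frob t = t1" "frob t1 = t2" "frob t2 = s"
    using t3 s3 by (simp_all add: s1_def s2_def t1_def t2_def)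
  have fc0: "frob c0 \<noteq> c0"
    unfolding c0_eq by (rule frob_plus_inverse_neq[OF \<rho>(1,3) fl])
  \<comment> \<open>The three unwanted alternatives have this shape with \<tau> equal to t, s1 or
    s2. Comparing the first equation with its conjugate gives \<tau>^2 = Y^2, so \<tau> is fixed by
    the square of \<open>frob\<close>. Then c0 is fixed by the square and by the cube of
    \<open>frob\<close>, hence by \<open>frob\<close>.\<close>
  have bad: False if \<tau>: "\<tau> * frob \<tau> * frob (frob \<tau>) = Y * \<mu>" "\<tau> * frob (frob (frob \<tau>)) = \<mu>"
      "\<tau> + frob (frob (frob \<tau>)) = c" "c = c0 \<or> c = c1 \<or> c = c2" and Y: "Y = Z \<or> Y = Z'" for \<tau> Y c
  proof -
    have Y': "Y * frob Y = \<mu>" "frob (frob Y) = Y" "frob Y \<noteq> 0"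
      using Y Z_prod Z_nz Z'_nz by (auto simp: fZ mult.commute)
    define x where "x = frob \<tau> * frob (frob \<tau>)"
    have 1: "\<tau> * x = Y * \<mu>" using \<tau>(1) by (simp add: x_def mult.assoc)
    have 2: "frob (frob (frob \<tau>)) * x = frob Y * \<mu>"
      using arg_cong[OF \<tau>(1), of frob] by (simp add: x_def f\<mu> mult_ac)
    have "\<tau> * (frob Y * \<mu>) = \<tau> * (frob (frob (frob \<tau>)) * x)" by (simp only: 2)
    also have "\<dots> = frob (frob (frob \<tau>)) * (\<tau> * x)" by (simp only: mult_ac)
    also have "\<dots> = frob (frob (frob \<tau>)) * (Y * \<mu>)" by (simp only: 1)
    finally have "\<tau> * frob Y = frob (frob (frob \<tau>)) * Y" using \<mu>_nz by simp
    then have "\<tau> * (\<tau> * frob Y) = \<mu> * Y" by (metis \<tau>(2) mult.assoc)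
    also have "\<dots> = Y * Y * frob Y" using Y'(1) by (simp add: mult_ac)
    finally have "\<tau> * \<tau> = Y * Y" using Y'(3) by (simp add: mult.assoc[symmetric])
    then have "\<tau> = Y \<or> \<tau> = - Y" by (rule square_eq_iff[THEN iffD1])
    then have "frob (frob \<tau>) = \<tau>" using Y'(2) by auto
    then have "frob (frob c) = c" using \<tau>(3) by auto
    then have "frob (frob c0) = c0" using \<tau>(4) fc by (metis frob_eq_iff)
    with f3c fc0 show False by simp
  qed
  have "False" if "t * t2 = Y * s1" "Y = Z \<or> Y = Z'" for Y
  proof -
    have "t * t1 * t2 = t * t2 * t1" by (simp add: mult_ac)
    also have "\<dots> = Y * \<mu>" using that(1) ts1(2) by (simp add: mult_ac)
    finally show False
      using that(2) ts by (intro bad[of t Y c0]) (simp_all add: t4)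
  qed
  moreover have "False" if "t * s2 = Y * t1" "Y = Z \<or> Y = Z'" for Y
  proof -
    have "s1 * s2 * t = t * s2 * s1" by (simp add: mult_ac)
    also have "\<dots> = Y * \<mu>" using that(1) ts1(2) by (simp add: mult_ac)
    finally show False
      using that(2) ts1 by (intro bad[of s1 Y c1]) (simp_all add: t4 add.commute mult.commute)
  qed
  moreover have "False" if "t * s2 = Y * s1" "Y = Z \<or> Y = Z'" for Y
  proof -
    have "s2 * t * t1 = t * s2 * t1" by (simp add: mult_ac)
    also have "\<dots> = Y * \<mu>" using that(1) ts1(2) by (simp add: mult_ac)
    finally show False
      using that(2) ts2 by (intro bad[of s2 Y c2]) (simp_all add: t4 add.commute mult.commute)
  qed
  ultimately have "t * t2 = Z * t1 \<or> t * t2 = Z' * t1" using alt by blast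
  then have "t * t2 * s1 + t1 * s * s2 = \<mu> * la"
  proof
    assume *: "t * t2 = Z * t1"
    have **: "t1 * s = Z' * t2" using arg_cong[OF *, of frob] by (simp add: t4 fZ)
    have "t * t2 * s1 + t1 * s * s2 = Z * (t1 * s1) + Z' * (t2 * s2)"
      by (simp only: * ** mult.assoc)
    then show ?thesis unfolding ts1(2) ts2(2) Z_sum[symmetric] by (simp only: distrib_left mult.commute add.commute)
  next
    assume *: "t * t2 = Z' * t1"
    have **: "t1 * s = Z * t2" using arg_cong[OF *, of frob] by (simp add: t4 fZ)
    have "t * t2 * s1 + t1 * s * s2 = Z' * (t1 * s1) + Z * (t2 * s2)"
      by (simp only: * ** mult.assoc)
    then show ?thesis unfolding ts1(2) ts2(2) Z_sum[symmetric] by (simp only: distrib_left mult.commute add.commute)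
  qed
  then show thesis
    using that[of l \<mu> t] fl f\<mu> \<mu>_nz \<open>t \<in> K6\<close> t3 \<open>frob (frob (frob t)) \<noteq> t\<close> ts c0_eq
    by (simp add: t4 la_def)
qed

end

section \<open>The five-term relation and the absence of a sixth point\<close>

context field_endomorphism
begin

text \<open>The three distinct conjugates of c are roots of the same quadratic polynomial; taking
  divided differences at them isolates the coefficients.\<close>

lemma cubic_quadratic_zero:
  assumes c: "frob (frob (frob c)) = c" "frob c \<noteq> c"
    and fixed: "frob u = u" "frob v = v" "frob w = w"
    and eq: "u * c\<^sup>2 + v * c + w = 0"
  shows "u = 0" "v = 0"
proof -
  have eq1: "u * (frob c)\<^sup>2 + v * frob c + w = 0"
    using arg_cong[OF eq, of frob] by (simp add: fixed)
  have "(c - frob c) * (u * (c + frob c) + v) = (u * c\<^sup>2 + v * c + w) - (u * (frob c)\<^sup>2 + v * frob c + w)"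
    by (simp add: algebra_simps power2_eq_square)
  then have "(c - frob c) * (u * (c + frob c) + v) = 0" by (simp only: eq eq1) simp
  then have 1: "u * (c + frob c) + v = 0" using c(2) by simp
  have 2: "u * (frob c + frob (frob c)) + v = 0"
    using arg_cong[OF 1, of frob] by (simp add: fixed)
  have "u * (c - frob (frob c)) = (u * (c + frob c) + v) - (u * (frob c + frob (frob c)) + v)"
    by (simp add: algebra_simps)
  then have "u * (c - frob (frob c)) = 0" by (simp only: 1 2) simp
  moreover have "frob (frob c) \<noteq> c" using c by auto
  ultimately show "u = 0" by simp
  then show "v = 0" using 1 by simp
qed

text \<open>Comparing the parts antisymmetric under the third power of frob shows that x, suitably
  rescaled, differs from t by an element f of F_(q^3). Then f lies in the span of 1 and
  c = t + t_3 over F_q, and the norm of t + f can only lie in F_q for f = 0 or f = - c.\<close>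

lemma span_point_vec_conjugates:
  assumes e: "frob (frob (frob e)) = e" "e \<noteq> 0"
    and \<rho>: "\<rho> = frob (frob e) / frob e" "frob \<rho> \<noteq> \<rho>"
    and t: "t \<in> K6" "frob (frob (frob t)) \<noteq> t" "t * frob (frob (frob t)) = \<mu>"
      "t + frob (frob (frob t)) = l + \<rho> + 1 / \<rho>"
    and fixed: "frob \<mu> = \<mu>" "frob l = l"
    and x: "x \<in> K6" "x \<noteq> 0"
    and \<beta>: "frob \<beta>1 = \<beta>1" "frob \<beta>2 = \<beta>2" "frob \<beta>3 = \<beta>3" "frob \<beta> = \<beta>" "\<beta> \<noteq> 0"
    and A: "fst (point_vec x) = \<beta>1 * fst (point_vec 1) + \<beta>2 * fst (point_vec e)
      + \<beta>3 * fst (point_vec (1 / e)) + \<beta> * fst (point_vec t)"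
    and B: "fst (snd (point_vec x)) = \<beta>1 * fst (snd (point_vec 1)) + \<beta>2 * fst (snd (point_vec e))
      + \<beta>3 * fst (snd (point_vec (1 / e))) + \<beta> * fst (snd (point_vec t))"
  obtains k where "frob k = k" "k \<noteq> 0" "x = k * t \<or> x = k * frob (frob (frob t))"
proof -
  define F3 where "F3 y = frob (frob (frob y))" for y
  have F3_hom [simp]: "F3 (a + b) = F3 a + F3 b" "F3 (a - b) = F3 a - F3 b" "F3 (a * b) = F3 a * F3 b"
    "F3 (a / b) = F3 a / F3 b" "F3 (frob a) = frob (F3 a)" for a b by (simp_all add: F3_def)
  define e1 where "e1 = frob e"
  define e2 where "e2 = frob e1"
  have fe2: "frob e2 = e" using e(1) by (simp add: e1_def e2_def)
  then have fe1: "frob (frob e1) = e" by (simp add: e2_def)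
  have e_nz: "e1 \<noteq> 0" "e2 \<noteq> 0" using e(2) by (simp_all add: e1_def e2_def)
  define \<nu> where "\<nu> = e * e1 * e2"
  have \<nu>: "\<nu> \<noteq> 0" "frob \<nu> = \<nu>" using e(2) e_nz by (simp_all add: \<nu>_def fe2 mult_ac flip: e1_def e2_def)
  have \<rho>e: "\<rho> = e2 / e1" by (simp add: \<rho> e1_def e2_def)
  have \<rho>1: "frob \<rho> = e / e2" by (simp add: \<rho>e fe2 flip: e2_def)
  have \<rho>2: "frob (frob \<rho>) = e1 / e" by (simp add: \<rho>1 fe2 flip: e1_def)
  have \<rho>3: "F3 \<rho> = \<rho>" by (simp add: F3_def \<rho>2) (simp add: \<rho>e flip: e1_def e2_def)
  have \<rho>_nz: "\<rho> \<noteq> 0" using e_nz by (simp add: \<rho>e)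
  \<comment> \<open>For e in F_(q^3) the first coordinate of v(e) is \<open>e * e * e1\<close>,
    which is \<open>\<nu> * frob \<rho>\<close>, and that of v(1/e) is its inverse. Absorbing \<nu>,
    an element of F_q, leaves combinations of 1, \<rho> and 1/\<rho> up to conjugation.\<close>
  define \<gamma>2 where "\<gamma>2 = \<beta>2 * \<nu>"
  define \<gamma>3 where "\<gamma>3 = \<beta>3 / \<nu>"
  have f\<gamma>: "frob \<gamma>2 = \<gamma>2" "frob \<gamma>3 = \<gamma>3" by (simp_all add: \<gamma>2_def \<gamma>3_def \<beta> \<nu>)
  define n where "n = x * F3 x"
  have \<mu>: "t * F3 t = \<mu>" using t(3) by (simp add: F3_def)
  have "\<mu> \<noteq> 0" using t(2,3) by auto
  have A': "n * frob x = \<beta>1 + \<gamma>2 * frob \<rho> + \<gamma>3 / frob \<rho> + \<beta> * \<mu> * frob t"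
  proof -
    have "\<beta>2 * (e * e * e1) = \<gamma>2 * frob \<rho>" "\<beta>3 * (1 / e * (1 / e) * (1 / e1)) = \<gamma>3 / frob \<rho>"
      using e(2) e_nz by (simp_all add: \<gamma>2_def \<gamma>3_def \<nu>_def \<rho>1)
    then show ?thesis using A by (simp add: point_vec_def n_def F3_def fe1 t(3) mult.assoc flip: e1_def)
  qed
  have B': "n * frob (frob x) = \<beta>1 + \<gamma>2 / frob (frob \<rho>) + \<gamma>3 * frob (frob \<rho>) + \<beta> * \<mu> * frob (frob t)"
  proof -
    have "\<beta>2 * (e * e * e2) = \<gamma>2 / frob (frob \<rho>)" "\<beta>3 * (1 / e * (1 / e) * (1 / e2)) = \<gamma>3 * frob (frob \<rho>)"
      using e(2) e_nz by (simp_all add: \<gamma>2_def \<gamma>3_def \<nu>_def \<rho>2)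
    then show ?thesis using B by (simp add: point_vec_def n_def F3_def fe2 t(3) mult.assoc flip: e1_def e2_def)
  qed
  have F3_fix: "F3 a = a" if "frob a = a" for a using that by (simp add: F3_def)
  have F3F3: "F3 (F3 x) = x" "F3 (F3 t) = t" using x(1) t(1) by (simp_all add: K6_def F3_def)
  have F3n: "F3 n = n" by (simp add: n_def F3F3 mult.commute)
  have n_nz: "n \<noteq> 0" using x(2) by (simp add: n_def F3_def)
  have A3: "n * frob (F3 x) = \<beta>1 + \<gamma>2 * frob \<rho> + \<gamma>3 / frob \<rho> + \<beta> * \<mu> * frob (F3 t)"
    using arg_cong[OF A', of F3] by (simp add: F3n F3_fix[OF \<beta>(1)] F3_fix[OF \<beta>(4)] F3_fix[OF f\<gamma>(1)] F3_fix[OF f\<gamma>(2)] F3_fix[OF fixed(1)] \<rho>3)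
  have B3: "n * frob (frob (F3 x)) = \<beta>1 + \<gamma>2 / frob (frob \<rho>) + \<gamma>3 * frob (frob \<rho>) + \<beta> * \<mu> * frob (frob (F3 t))"
    using arg_cong[OF B', of F3] by (simp add: F3n F3_fix[OF \<beta>(1)] F3_fix[OF \<beta>(4)] F3_fix[OF f\<gamma>(1)] F3_fix[OF f\<gamma>(2)] F3_fix[OF fixed(1)] \<rho>3)
  \<comment> \<open>The terms with \<beta>1, \<gamma>2, \<gamma>3 are fixed by \<open>F3\<close> and
    cancel in the differences. The first coordinate then determines \<open>n * frob z\<close>, the
    second \<open>n * frob (frob z)\<close>, with the same value; this puts z and n into
    F_q.\<close>
  define z where "z = (x - F3 x) / (t - F3 t)"
  have tt: "t - F3 t \<noteq> 0" using t(2) by (simp add: F3_def)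
  have zt: "z * (t - F3 t) = x - F3 x" using tt by (simp add: z_def)
  have nz1: "n * frob z = \<beta> * \<mu>"
  proof -
    have "n * (frob x - frob (F3 x)) = \<beta> * \<mu> * (frob t - frob (F3 t))"
      using A' A3 by (simp add: algebra_simps)
    moreover have "frob z * frob (t - F3 t) = frob x - frob (F3 x)"
      using arg_cong[OF zt, of frob] by simp
    ultimately have "(n * frob z - \<beta> * \<mu>) * frob (t - F3 t) = 0"
      by (simp add: left_diff_distrib mult.assoc)
    then show ?thesis using tt by (simp only: mult_eq_0_iff frob_eq_0_iff) simp
  qed
  have nz2: "n * frob (frob z) = \<beta> * \<mu>"
  proof -
    have "n * (frob (frob x) - frob (frob (F3 x))) = \<beta> * \<mu> * (frob (frob t) - frob (frob (F3 t)))"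
      using B' B3 by (simp add: algebra_simps)
    moreover have "frob (frob z) * frob (frob (t - F3 t)) = frob (frob x) - frob (frob (F3 x))"
      using arg_cong[OF zt, of "\<lambda>x. frob (frob x)"] by simp
    ultimately have "(n * frob (frob z) - \<beta> * \<mu>) * frob (frob (t - F3 t)) = 0"
      by (simp add: left_diff_distrib mult.assoc)
    then show ?thesis using tt by (simp only: mult_eq_0_iff frob_eq_0_iff) simp
  qed
  have fz: "frob z = z" using nz1 nz2 n_nz by (metis frob_eq_iff mult_left_cancel)
  have z_nz: "z \<noteq> 0" using nz1 \<beta>(5) \<open>\<mu> \<noteq> 0\<close> by auto
  have nz: "n * z = \<beta> * \<mu>" using nz1 fz by simp
  have fn: "frob n = n"
  proof -
    have "frob n * z = \<beta> * \<mu>" using arg_cong[OF nz, of frob] by (simp add: fz \<beta> fixed)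
    then show ?thesis using nz z_nz by (metis mult_right_cancel)
  qed
  define f where "f = x / z - t"
  have xf: "x = z * (t + f)" using z_nz by (simp add: f_def)
  have F3z: "F3 z = z" by (rule F3_fix[OF fz])
  have F3f: "F3 f = f"
  proof -
    have "z * (F3 f - f) = (z * (t - F3 t)) - (x - F3 x)"
      using z_nz by (simp add: f_def F3z right_diff_distrib)
    then show ?thesis using zt z_nz by simp
  qed
  have f1: "\<beta> * \<mu> * f = \<beta>1 + \<gamma>2 * \<rho> + \<gamma>3 / \<rho>"
  proof -
    have "n * frob x = \<beta> * \<mu> * frob (t + f)" using nz by (simp add: xf fz mult_ac)
    with A' have "\<beta> * \<mu> * frob f = \<beta>1 + \<gamma>2 * frob \<rho> + \<gamma>3 / frob \<rho>" by (simp add: distrib_left)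
    then have "frob (\<beta> * \<mu> * f) = frob (\<beta>1 + \<gamma>2 * \<rho> + \<gamma>3 / \<rho>)" by (simp add: \<beta> fixed f\<gamma>)
    then show ?thesis by (simp only: frob_eq_iff)
  qed
  have f2: "\<beta> * \<mu> * f = \<beta>1 + \<gamma>2 / \<rho> + \<gamma>3 * \<rho>"
  proof -
    have "n * frob (frob x) = \<beta> * \<mu> * frob (frob (t + f))" using nz by (simp add: xf fz mult_ac)
    with B' have "\<beta> * \<mu> * frob (frob f) = \<beta>1 + \<gamma>2 / frob (frob \<rho>) + \<gamma>3 * frob (frob \<rho>)" by (simp add: distrib_left)
    then have "frob (frob (\<beta> * \<mu> * f)) = frob (frob (\<beta>1 + \<gamma>2 / \<rho> + \<gamma>3 * \<rho>))" by (simp add: \<beta> fixed f\<gamma>)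
    then show ?thesis by (simp only: frob_eq_iff)
  qed
  \<comment> \<open>The two coordinates express f by the same formula with \<gamma>2 and \<gamma>3
    interchanged.\<close>
  have "(\<gamma>2 - \<gamma>3) * (\<rho> - 1 / \<rho>)
      = (\<beta>1 + \<gamma>2 * \<rho> + \<gamma>3 / \<rho>) - (\<beta>1 + \<gamma>2 / \<rho> + \<gamma>3 * \<rho>)"
    by (simp add: algebra_simps diff_divide_distrib)
  then have "(\<gamma>2 - \<gamma>3) * (\<rho> - 1 / \<rho>) = 0" by (simp flip: f1 f2)
  moreover have "\<rho> \<noteq> 1 / \<rho>"
  proof
    assume "\<rho> = 1 / \<rho>"
    then have "\<rho> * \<rho> = 1" using \<rho>_nz by (simp add: field_simps)
    then have "\<rho> = 1 \<or> \<rho> = - 1" by (simp add: square_eq_1_iff)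
    with \<rho>(2) show False by auto
  qed
  ultimately have \<gamma>23: "\<gamma>2 = \<gamma>3" by simp
  define c where "c = l + \<rho> + 1 / \<rho>"
  have c_tt: "c = t + F3 t" using t(4) by (simp add: c_def F3_def)
  define g2 where "g2 = \<gamma>2 / (\<beta> * \<mu>)"
  define g1 where "g1 = \<beta>1 / (\<beta> * \<mu>) - g2 * l"
  have fg: "frob g1 = g1" "frob g2 = g2" by (simp_all add: g1_def g2_def \<beta> fixed f\<gamma>)
  have fc: "f = g1 + g2 * c"
  proof -
    have g2: "\<beta> * \<mu> * g2 = \<gamma>2" using \<beta>(5) \<open>\<mu> \<noteq> 0\<close> by (simp add: g2_def)
    have "\<beta> * \<mu> * g1 = \<beta>1 - \<beta> * \<mu> * g2 * l"
      using \<beta>(5) \<open>\<mu> \<noteq> 0\<close> by (simp add: g1_def right_diff_distrib)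
    then have "\<beta> * \<mu> * (g1 + g2 * c) = \<beta>1 + (\<beta> * \<mu> * g2) * (c - l)"
      by (simp add: algebra_simps)
    then have "\<beta> * \<mu> * (g1 + g2 * c) = \<beta>1 + \<gamma>2 * \<rho> + \<gamma>2 / \<rho>"
      unfolding g2 by (simp add: c_def algebra_simps)
    then have "\<beta> * \<mu> * f = \<beta> * \<mu> * (g1 + g2 * c)" using f1 \<gamma>23 by simp
    then show ?thesis using \<beta>(5) \<open>\<mu> \<noteq> 0\<close> by simp
  qed
  define m where "m = (t + f) * (F3 t + f)"
  have "n = z * z * m" using arg_cong[OF xf, of F3] by (simp add: n_def m_def xf F3z F3f mult_ac)
  then have "z * z * frob m = z * z * m" using fn fz by (metis frob_mult)
  then have fm: "frob m = m" using z_nz by simp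
  have "m = t * F3 t + f * (t + F3 t) + f * f" by (simp add: m_def algebra_simps)
  then have "m = \<mu> + f * c + f * f" by (simp only: \<mu> c_tt)
  then have eq: "(g2 * (1 + g2)) * c\<^sup>2 + (g1 * (1 + 2 * g2)) * c + (\<mu> + g1 * g1 - m) = 0"
    by (simp add: fc algebra_simps power2_eq_square)
  have "F3 c = c" unfolding c_tt by (simp add: F3F3 add.commute)
  then have c3: "frob (frob (frob c)) = c" by (simp add: F3_def)
  have c1: "frob c \<noteq> c"
    unfolding c_def by (rule frob_plus_inverse_neq) (use \<rho>3 \<rho>(2) fixed in \<open>simp_all add: F3_def\<close>)
  have g: "g2 * (1 + g2) = 0" "g1 * (1 + 2 * g2) = 0"
    using cubic_quadratic_zero[OF c3 c1 _ _ _ eq] by (simp_all add: fg fixed fm)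
  \<comment> \<open>As g2 is 0 or -1, the factor \<open>1 + 2 * g2\<close> is 1 or -1, nonzero in
    every characteristic, and g1 vanishes.\<close>
  have "f = 0 \<or> f = - c"
  proof (cases "g2 = 0")
    case True
    then show ?thesis using g(2) by (simp add: fc)
  next
    case False
    then have "g2 = - 1" using g(1) by (simp add: add_eq_0_iff)
    then show ?thesis using g(2) by (simp add: fc)
  qed
  then show thesis
  proof
    assume "f = 0"
    then show thesis using that[of z] fz z_nz xf by simp
  next
    assume "f = - c"
    then have "x = - z * F3 t" using xf by (simp add: c_tt)
    then show thesis using that[of "- z"] fz z_nz by (simp add: F3_def)
  qed
qed

text \<open>Divided by \<mu>, the first two coordinates are the first and second conjugates of the
  equation for t + t_3. The third is the trace condition: \<open>1\<close>, \<open>e\<close> and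
  \<open>1 / e\<close> contribute \<mu> l, \<mu> and \<mu>, because the third coordinate of v(e) is
  \<nu>.\<close>

lemma point_vec_dependency:
  assumes e: "frob (frob (frob e)) = e" "e \<noteq> 0"
    and \<rho>: "\<rho> = frob (frob e) / frob e"
    and t: "t \<in> K6" "t * frob (frob (frob t)) = \<mu>" "t + frob (frob (frob t)) = l + \<rho> + 1 / \<rho>"
      "t * frob (frob t) * frob (frob (frob (frob t)))
      + frob t * frob (frob (frob t)) * frob (frob (frob (frob (frob t)))) = \<mu> * (l + 2)"
    and fixed: "frob \<mu> = \<mu>" "frob l = l"
    and \<nu>: "\<nu> = e * frob e * frob (frob e)"
  shows "fst (point_vec (frob (frob (frob t)))) = \<mu> * l * fst (point_vec 1) + \<mu> / \<nu> * fst (point_vec e)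
      + \<mu> * \<nu> * fst (point_vec (1 / e)) - fst (point_vec t)"
    "fst (snd (point_vec (frob (frob (frob t))))) = \<mu> * l * fst (snd (point_vec 1)) + \<mu> / \<nu> * fst (snd (point_vec e))
      + \<mu> * \<nu> * fst (snd (point_vec (1 / e))) - fst (snd (point_vec t))"
    "snd (snd (point_vec (frob (frob (frob t))))) = \<mu> * l * snd (snd (point_vec 1)) + \<mu> / \<nu> * snd (snd (point_vec e))
      + \<mu> * \<nu> * snd (snd (point_vec (1 / e))) - snd (snd (point_vec t))"
proof -
  define e1 where "e1 = frob e"
  define e2 where "e2 = frob e1"
  have fe2: "frob e2 = e" using e(1) by (simp add: e1_def e2_def)
  then have fe1: "frob (frob e1) = e" by (simp add: e2_def)
  have e_nz: "e1 \<noteq> 0" "e2 \<noteq> 0" using e(2) by (simp_all add: e1_def e2_def)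
  have \<nu>: "\<nu> = e * e1 * e2" by (simp add: \<nu> e1_def e2_def)
  have \<rho>e: "\<rho> = e2 / e1" by (simp add: \<rho> e1_def e2_def)
  have \<rho>1: "frob \<rho> = e / e2" by (simp add: \<rho>e fe2 flip: e2_def)
  have \<rho>2: "frob (frob \<rho>) = e1 / e" by (simp add: \<rho>1 fe2 flip: e1_def)
  have t6: "frob (frob (frob (frob (frob (frob t))))) = t" using t(1) by (simp add: K6_def)
  define s where "s = frob (frob (frob t))"
  have fs: "frob (frob (frob s)) = t" using t6 by (simp add: s_def)
  have ts: "t * s = \<mu>" "t + s = l + \<rho> + 1 / \<rho>" using t(2,3) by (simp_all add: s_def)
  have s1: "frob s = l + frob \<rho> + 1 / frob \<rho> - frob t"
    using arg_cong[OF ts(2), of frob] by (simp add: fixed eq_diff_eq add.commute)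
  have s2: "frob (frob s) = l + frob (frob \<rho>) + 1 / frob (frob \<rho>) - frob (frob t)"
    using arg_cong[OF s1, of frob] by (simp add: fixed)
  show "fst (point_vec (frob (frob (frob t)))) = \<mu> * l * fst (point_vec 1) + \<mu> / \<nu> * fst (point_vec e)
      + \<mu> * \<nu> * fst (point_vec (1 / e)) - fst (point_vec t)"
  proof -
    have a: "fst (point_vec s) = \<mu> * frob s" "fst (point_vec t) = \<mu> * frob t"
      using ts(1) by (simp_all add: point_vec_def fs mult.commute flip: s_def)
    have b: "\<mu> / \<nu> * fst (point_vec e) = \<mu> * frob \<rho>" "\<mu> * \<nu> * fst (point_vec (1 / e)) = \<mu> / frob \<rho>"
      using e e_nz by (simp_all add: point_vec_def \<nu> \<rho>1 fe1 flip: e1_def)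
    have "fst (point_vec 1) = 1" by (simp add: point_vec_def)
    then show ?thesis unfolding s_def[symmetric] a b s1 by (simp add: algebra_simps)
  qed
  show "fst (snd (point_vec (frob (frob (frob t))))) = \<mu> * l * fst (snd (point_vec 1)) + \<mu> / \<nu> * fst (snd (point_vec e))
      + \<mu> * \<nu> * fst (snd (point_vec (1 / e))) - fst (snd (point_vec t))"
  proof -
    have a: "fst (snd (point_vec s)) = \<mu> * frob (frob s)" "fst (snd (point_vec t)) = \<mu> * frob (frob t)"
      using ts(1) by (simp_all add: point_vec_def fs mult.commute flip: s_def)
    have b: "\<mu> / \<nu> * fst (snd (point_vec e)) = \<mu> / frob (frob \<rho>)" "\<mu> * \<nu> * fst (snd (point_vec (1 / e))) = \<mu> * frob (frob \<rho>)"
      using e e_nz by (simp_all add: point_vec_def \<nu> \<rho>2 fe2 flip: e1_def e2_def)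
    have "fst (snd (point_vec 1)) = 1" by (simp add: point_vec_def)
    then show ?thesis unfolding s_def[symmetric] a b s2 by (simp add: algebra_simps)
  qed
  show "snd (snd (point_vec (frob (frob (frob t))))) = \<mu> * l * snd (snd (point_vec 1)) + \<mu> / \<nu> * snd (snd (point_vec e))
      + \<mu> * \<nu> * snd (snd (point_vec (1 / e))) - snd (snd (point_vec t))"
  proof -
    have a: "snd (snd (point_vec s)) + snd (snd (point_vec t)) = \<mu> * (l + 2)"
      using t(4) t6 by (simp add: point_vec_def fs s_def add_ac mult_ac)
    have b: "\<mu> / \<nu> * snd (snd (point_vec e)) = \<mu>" "\<mu> * \<nu> * snd (snd (point_vec (1 / e))) = \<mu>"
      using e e_nz by (simp_all add: point_vec_def \<nu> fe2 flip: e1_def e2_def)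
    have "snd (snd (point_vec 1)) = 1" by (simp add: point_vec_def)
    then show ?thesis unfolding s_def[symmetric] b eq_diff_eq a by (simp add: algebra_simps)
  qed
qed

end

section \<open>Finite fields inside the algebraic closure\<close>

lemma finite_field_power_card:
  fixes a :: "'a::{field,finite}"
  shows "a ^ CARD('a) = a"
proof (cases "a = 0")
  case False
  have bij: "bij_betw ((*) a) (UNIV - {0}) (UNIV - {0})"
    by (rule bij_betwI[where g = "\<lambda>x. x / a"]) (use False in auto)
  have "(\<Prod>x\<in>UNIV - {0}. x) = (\<Prod>x\<in>UNIV - {0}. a * x)"
    using prod.reindex_bij_betw[OF bij, of "\<lambda>x. x"] by simp
  also have "\<dots> = a ^ (CARD('a) - 1) * (\<Prod>x\<in>UNIV - {0}. x)"
    by (simp add: prod.distrib)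
  finally have "a ^ (CARD('a) - 1) = 1" by simp
  then have "a ^ Suc (CARD('a) - 1) = a" by (simp only: power_Suc) simp
  then show ?thesis using finite_UNIV_card_ge_0[where 'a = 'a] by simp
qed (simp add: card_gt_0_iff)

lemma of_nat_card_eq_0: "of_nat CARD('a) = (0 :: 'a::{field,finite})"
proof -
  have "(\<Sum>x\<in>UNIV. x) = (\<Sum>x\<in>UNIV. x + (1::'a))"
    by (rule sum.reindex_bij_witness[of _ "\<lambda>x. x + 1" "\<lambda>x. x - 1"]) auto
  then show ?thesis by (simp add: sum.distrib)
qed

lemma card_field_gt_1: "1 < CARD('a::{field,finite})"
proof -
  have "card {0, 1 :: 'a} \<le> CARD('a)" by (intro card_mono) auto
  then show ?thesis by simp
qed

text \<open>The ambient field is the algebraic closure: it contains F_(q^2), F_(q^3) and F_(q^6)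
  together, as fixed sets of iterates of one map, and supplies roots of quadratics.\<close>

definition frob :: "'a::{field,finite} alg_closure \<Rightarrow> 'a alg_closure" where
  "frob x = x ^ CARD('a)"

lemma frob_mult: "frob (x * y) = frob x * frob y"
  by (simp add: frob_def power_mult_distrib)

lemma frob_to_ac [simp]: "frob (to_ac a) = to_ac a"
  unfolding frob_def by (metis to_ac_power finite_field_power_card)

lemma degree_less_if_coeff_eq_0:
  assumes "Polynomial.degree p \<le> n" "Polynomial.coeff p n = 0" "n > 0"
  shows "Polynomial.degree p < n"
  using assms by (metis degree_0 le_neq_implies_less leading_coeff_0_iff)

text \<open>Additivity of the Frobenius map: (X + 1)^q - X^q - 1 has degree below q and vanishes on
  the q elements of the ground field.\<close>

lemma frob_add_1: "frob (x + 1) = frob x + (1 :: 'a::{field,finite} alg_closure)"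
proof -
  define n where "n = CARD('a)"
  have n: "n > 1" unfolding n_def by (rule card_field_gt_1)
  define p :: "'a alg_closure poly" where "p = [:1, 1:] ^ n - Polynomial.monom 1 n - 1"
  have cf: "Polynomial.coeff ([:1, 1:] ^ n) n = (1 :: 'a alg_closure)"
    using coeff_linear_power[of "1 :: 'a alg_closure" n] by simp
  have "Polynomial.degree p \<le> n"
    unfolding p_def
    by (intro degree_diff_le degree_monom_le) (auto simp: degree_linear_power)
  moreover have "Polynomial.coeff p n = 0"
    using n by (simp add: p_def cf)
  ultimately have deg: "Polynomial.degree p < n"
    using n by (intro degree_less_if_coeff_eq_0) auto
  have "p = 0"
  proof (rule ccontr)
    assume "p \<noteq> 0"
    have "range to_ac \<subseteq> {x. poly p x = 0}"
    proof clarify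
      fix a :: 'a
      have "frob (to_ac (a + 1)) = frob (to_ac a) + 1" by (simp only: frob_to_ac) simp
      then show "poly p (to_ac a) = 0"
        by (simp add: p_def poly_monom frob_def n_def add.commute)
    qed
    then have "card (range (to_ac :: 'a \<Rightarrow> _)) \<le> card {x. poly p x = 0}"
      using poly_roots_finite[OF \<open>p \<noteq> 0\<close>] card_mono by blast
    also have "\<dots> \<le> Polynomial.degree p" using card_poly_roots_bound[OF \<open>p \<noteq> 0\<close>] .
    finally show False using deg by (simp add: card_image inj_to_ac n_def)
  qed
  then have "poly p x = 0" by simp
  then show ?thesis
    by (simp add: p_def poly_monom frob_def n_def add.commute algebra_simps)
qed

lemma frob_add: "frob (x + y) = frob x + frob y"
proof (cases "y = 0")
  case False
  have "frob (x + y) = frob (y * (x / y + 1))" using False by (simp add: distrib_left)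
  also have "\<dots> = frob (y * (x / y)) + frob y"
    by (simp only: frob_mult frob_add_1) (simp only: distrib_left mult_1_right)
  also have "\<dots> = frob x + frob y" using False by simp
  finally show ?thesis .
qed (simp add: frob_def card_gt_0_iff)

interpretation frob: field_endomorphism "frob :: 'a::{field,finite} alg_closure \<Rightarrow> 'a alg_closure"
  by (unfold_locales, rule frob_add, rule frob_mult, simp add: frob_def)

lemma funpow_frob: "(frob ^^ n) x = (x :: 'a::{field,finite} alg_closure) ^ (CARD('a) ^ n)"
  proof (induction n)
  case (Suc n)
  then show ?case by (simp add: frob_def) (metis power_mult mult.commute)
qed simp

text \<open>The polynomial X^Q - X with Q = q^n splits over the algebraic closure, and its
  derivative -1 rules out repeated roots.\<close>

lemma card_fixed_frob:
  assumes "n > 0"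
  shows "card {x :: 'a::{field,finite} alg_closure. (frob ^^ n) x = x} = CARD('a) ^ n"
proof -
  define Q where "Q = CARD('a) ^ n"
  have "1 < Q"
    unfolding Q_def using assms card_field_gt_1 by (intro one_less_power)
  define p :: "'a alg_closure poly" where "p = Polynomial.monom 1 Q - [:0, 1:]"
  have "Polynomial.coeff [:0, 1 :: 'a alg_closure:] Q = 0" using \<open>1 < Q\<close> by (intro coeff_eq_0) simp
  then have cf: "Polynomial.coeff p Q = 1" by (simp add: p_def)
  then have "p \<noteq> 0" by auto
  have deg: "Polynomial.degree p = Q"
  proof (rule antisym)
    show "Polynomial.degree p \<le> Q"
      using \<open>1 < Q\<close> by (auto simp: p_def intro!: degree_diff_le degree_monom_le)
    show "Q \<le> Polynomial.degree p" by (intro le_degree) (simp add: cf)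
  qed
  have roots: "{x. poly p x = 0} = {x. (frob ^^ n) x = x}"
    by (auto simp: p_def poly_monom funpow_frob Q_def)
  have "of_nat Q = (0 :: 'a alg_closure)"
    unfolding Q_def of_nat_power using assms
    by (metis of_nat_card_eq_0 to_ac_0 to_ac_of_nat zero_power)
  then have pd: "pderiv p = -1"
    by (simp add: p_def pderiv_diff pderiv_monom pderiv_pCons one_pCons)
  obtain A where A: "size A = Polynomial.degree p" "p = Polynomial.smult (Polynomial.lead_coeff p) (\<Prod>x\<in>#A. [:-x, 1:])"
    using alg_closed_imp_factorization[OF \<open>p \<noteq> 0\<close>] by blast
  have p_eq: "p = (\<Prod>x\<in>#A. [:-x, 1:])" using A(2) cf deg by simp
  have count: "count A x \<le> 1" for x
  proof (rule ccontr)
    assume "\<not> count A x \<le> 1"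
    then have "{#x, x#} \<subseteq># A" by (simp add: subseteq_mset_def)
    then obtain B where "A = {#x, x#} + B" by (metis subset_mset.le_iff_add)
    then have "p = [:-x, 1:] * ([:-x, 1:] * (\<Prod>x\<in>#B. [:-x, 1:]))" by (simp add: p_eq)
    then have "poly (pderiv p) x = 0" by (simp only: pderiv_mult poly_add poly_mult) simp
    then show False by (simp add: pd)
  qed
  have "A = mset_set (set_mset A)"
    proof (intro multiset_eqI)
    fix x
    show "count A x = count (mset_set (set_mset A)) x"
      using count[of x] by (cases "x \<in># A") (auto simp: count_eq_zero_iff le_Suc_eq)
  qed
  then have "size A = card (set_mset A)" by (metis size_mset_set)
  moreover have "set_mset A = {x. poly p x = 0}"
    by (auto simp: p_eq poly_prod_mset prod_mset_zero_iff image_iff)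
  ultimately show ?thesis using A(1) deg roots Q_def by simp
qed

lemma range_to_ac_eq: "range (to_ac :: 'a::{field,finite} \<Rightarrow> _) = {x. frob x = x}"
proof (rule card_subset_eq)
  have c: "card {x :: 'a alg_closure. frob x = x} = CARD('a)"
    using card_fixed_frob[of 1, where 'a = 'a] by simp
  then show "finite {x :: 'a alg_closure. frob x = x}"
    by (intro card_ge_0_finite) (simp add: card_gt_0_iff)
  show "range (to_ac :: 'a \<Rightarrow> _) \<subseteq> {x. frob x = x}" by auto
  show "card (range (to_ac :: 'a \<Rightarrow> _)) = card {x :: 'a alg_closure. frob x = x}"
    using c by (simp add: card_image inj_to_ac)
qed

lemma obtain_to_ac:
  assumes "frob x = x"
  obtains a where "x = to_ac a"
  using assms range_to_ac_eq by blast

section \<open>Linear algebra over a finite field\<close>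

lemma (in vector_space) card_span_independent:
  assumes "finite B" "independent B"
  shows "card (span B) = card (UNIV :: 'a set) ^ card B"
  using assms
proof (induction B)
  case (insert b B)
  have indep: "independent B" and b: "b \<notin> span B"
    using insert by (auto simp: independent_insert)
  have "span (insert b B) = (\<lambda>(k, x). scale k b + x) ` (UNIV \<times> span B)"
  proof (intro equalityI subsetI)
    fix x assume "x \<in> span (insert b B)"
    then obtain k where "x - scale k b \<in> span B" by (auto simp: span_insert)
    then show "x \<in> (\<lambda>(k, x). scale k b + x) ` (UNIV \<times> span B)"
      by (intro image_eqI[of _ _ "(k, x - scale k b)"]) auto
  next
    fix x assume "x \<in> (\<lambda>(k, x). scale k b + x) ` (UNIV \<times> span B)"
    then obtain k y where "y \<in> span B" "x = scale k b + y" by auto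
    then show "x \<in> span (insert b B)" by (auto simp: span_insert intro!: exI[of _ k])
  qed
  moreover have "inj_on (\<lambda>(k, x). scale k b + x) (UNIV \<times> span B)"
  proof (rule inj_onI, clarify)
    fix k x k' x' assume x: "x \<in> span B" "x' \<in> span B" and eq: "scale k b + x = scale k' b + x'"
    have "scale (k - k') b = x' - x" using eq by (simp add: scale_left_diff_distrib algebra_simps)
    then have "scale (k - k') b \<in> span B" using x by (simp add: span_diff)
    then have "scale (inverse (k - k')) (scale (k - k') b) \<in> span B" by (rule span_scale)
    moreover have "scale (inverse (k - k')) (scale (k - k') b) = b" if "k \<noteq> k'" using that by simp
    ultimately have "k = k'" using b by metis
    then show "k = k' \<and> x = x'" using eq by simp
  qed
  ultimately have "card (span (insert b B)) = card ((UNIV :: 'a set) \<times> span B)"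
    by (simp add: card_image)
  then show ?case using insert indep by (simp add: card_cartesian_product)
qed simp

text \<open>The dimension of V is read off from its cardinality, which spares the construction of an
  explicit basis.\<close>

lemma (in vector_space) coordinates_exist:
  fixes V :: "'b set"
  assumes "subspace V" "finite V" and cardV: "card V = card (UNIV :: 'a set) ^ CARD('n::finite)"
    and "card (UNIV :: 'a set) > 1"
  obtains \<Psi> :: "'a ^ 'n \<Rightarrow> 'b" where "\<And>x y. \<Psi> (x + y) = \<Psi> x + \<Psi> y"
    "\<And>c x. \<Psi> (c *s x) = scale c (\<Psi> x)" "inj \<Psi>" "range \<Psi> = V"
proof -
  obtain B where B: "B \<subseteq> V" "independent B" "V \<subseteq> span B" "card B = dim V"
    using basis_exists by blast
  have finB: "finite B" using B(1) \<open>finite V\<close> finite_subset by blast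
  have spanB: "span B = V" using B \<open>subspace V\<close> by (simp add: span_subspace)
  have "card (UNIV :: 'a set) ^ card B = card (UNIV :: 'a set) ^ CARD('n)"
    using card_span_independent[OF finB B(2)] cardV spanB by simp
  then have "card B = CARD('n)" using assms(4) by simp
  then obtain g :: "'n \<Rightarrow> 'b" where g: "bij_betw g UNIV B"
    using finB finite_same_card_bij[of "UNIV :: 'n set" B] by auto
  define \<Psi> :: "'a ^ 'n \<Rightarrow> 'b" where "\<Psi> x = (\<Sum>i\<in>UNIV. scale (x $ i) (g i))" for x
  have add: "\<Psi> (x + y) = \<Psi> x + \<Psi> y" for x y
    by (simp add: \<Psi>_def scale_left_distrib sum.distrib)
  have sc: "\<Psi> (c *s x) = scale c (\<Psi> x)" for c x
    by (simp add: \<Psi>_def scale_sum_right)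
  have \<Psi>_B: "\<Psi> x = (\<Sum>v\<in>B. scale (x $ (inv_into UNIV g v)) v)" for x
    unfolding \<Psi>_def
    by (rule sum.reindex_bij_witness[of _ "inv_into UNIV g" g])
      (use g in \<open>auto simp: bij_betw_def inv_into_f_f f_inv_into_f\<close>)
  have zero: "x = 0" if "\<Psi> x = 0" for x
  proof -
    have "x $ (inv_into UNIV g v) = 0" if "v \<in> B" for v
      using independentD[OF B(2) finB order_refl, of "\<lambda>v. x $ (inv_into UNIV g v)" v]
        \<open>\<Psi> x = 0\<close> that by (simp add: \<Psi>_B)
    then have "x $ i = 0" for i
      using g by (metis UNIV_I bij_betw_apply bij_betw_inv_into_left)
    then show ?thesis by (simp add: vec_eq_iff)
  qed
  have "inj \<Psi>"
  proof (rule injI)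
    fix x y assume "\<Psi> x = \<Psi> y"
    have "\<Psi> (x + (-1) *s y) = 0" unfolding add sc by (simp add: \<open>\<Psi> x = \<Psi> y\<close>)
    then have "x + (-1) *s y = 0" by (rule zero)
    then show "x = y" by (simp add: vec_eq_iff)
  qed
  moreover have "range \<Psi> = V"
  proof
    show "range \<Psi> \<subseteq> V"
    proof clarify
      fix x
      have "g i \<in> span B" for i using g by (intro span_base) (auto simp: bij_betw_def)
      then show "\<Psi> x \<in> V" unfolding spanB[symmetric] \<Psi>_def by (intro span_sum span_scale)
    qed
    show "V \<subseteq> range \<Psi>"
    proof
      fix v assume "v \<in> V"
      then have "v \<in> span B" using spanB by simp
      then obtain u where "v = (\<Sum>w\<in>B. scale (u w) w)"
        unfolding span_finite[OF finB] by auto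
      also have "\<dots> = \<Psi> (\<chi> i. u (g i))"
        unfolding \<Psi>_B using g
        by (intro sum.cong) (auto simp: bij_betw_def f_inv_into_f)
      finally show "v \<in> range \<Psi>" by simp
    qed
  qed
  ultimately show thesis using that add sc by blast
qed

lemma sum_powers_less:
  fixes q :: nat
  assumes "finite T" "1 < q" "\<And>i. i \<in> T \<Longrightarrow> i < n"
  shows "(\<Sum>i\<in>T. q ^ i) < q ^ n"
proof -
  have "(\<Sum>i\<in>T. q ^ i) \<le> (\<Sum>i<n. q ^ i)" using assms by (intro sum_mono2) auto
  also have "\<dots> < q ^ n"
  proof (induction n)
    case (Suc n)
    have "(\<Sum>i<Suc n. q ^ i) < 2 * q ^ n" using Suc by simp
    also have "\<dots> \<le> q ^ Suc n" using \<open>1 < q\<close> by simp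
    finally show ?case .
  qed simp
  finally show ?thesis .
qed

text \<open>Base-q expansions with digits 0 and 1 are unique: the powers below q^n add up to less
  than q^n, so the size of the sum decides the top digit. Distinct sets of conjugates thus give
  distinct exponents.\<close>

lemma inj_on_sum_powers:
  fixes q :: nat
  assumes "1 < q"
  shows "inj_on (\<lambda>T. \<Sum>i\<in>T. q ^ i) {T. T \<subseteq> {..<n}}"
proof (induction n)
  case (Suc n)
  show ?case
  proof (rule inj_onI, clarify)
    fix S T assume ST: "S \<subseteq> {..<Suc n}" "T \<subseteq> {..<Suc n}" and eq: "(\<Sum>i\<in>S. q ^ i) = (\<Sum>i\<in>T. q ^ i)"
    have fin: "finite S" "finite T" using ST finite_subset by blast+
    have lt: "(\<Sum>i\<in>S - {n}. q ^ i) < q ^ n" "(\<Sum>i\<in>T - {n}. q ^ i) < q ^ n"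
      using ST fin assms by (auto intro!: sum_powers_less simp: less_Suc_eq)
    have ge: "q ^ n \<le> (\<Sum>i\<in>U. q ^ i)" if "finite U" "n \<in> U" for U
      using that by (intro member_le_sum) auto
    have n: "n \<in> S \<longleftrightarrow> n \<in> T"
    proof -
      have "n \<in> U'" if "n \<in> U" "finite U" "(\<Sum>i\<in>U' - {n}. q ^ i) < q ^ n" "(\<Sum>i\<in>U. q ^ i) = (\<Sum>i\<in>U'. q ^ i)" for U U'
      proof (rule ccontr)
        assume "n \<notin> U'"
        then have "U' - {n} = U'" by simp
        with ge[OF that(2,1)] that(3,4) show False by simp
      qed
      from this[of S T] this[of T S] show ?thesis using fin lt eq by metis
    qed
    have "(\<Sum>i\<in>S - {n}. q ^ i) = (\<Sum>i\<in>T - {n}. q ^ i)"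
      unfolding sum_diff1_nat using n by (simp only: eq)
    moreover have "S - {n} \<subseteq> {..<n}" "T - {n} \<subseteq> {..<n}"
      using ST by (auto simp: less_Suc_eq)
    ultimately have "S - {n} = T - {n}" using Suc.IH by (auto simp: inj_on_def)
    then show "S = T" using n by blast
  qed
qed simp

lemma sum_fun_apply: "(\<Sum>i\<in>A. f i) x = (\<Sum>i\<in>A. f i x)"
  for f :: "'i \<Rightarrow> 'c \<Rightarrow> 'b::comm_monoid_add"
  by (induction A rule: infinite_finite_induct) simp_all

text \<open>Scalars come from the large field, since the functionals that read off the monomials
  have values there and not in F_q.\<close>

interpretation fun_space: vector_space "\<lambda>(c::'b::field) (f::'b \<Rightarrow> 'b) x. c * f x"
  by unfold_locales (auto simp: fun_eq_iff algebra_simps)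

text \<open>A nonzero polynomial of degree below \<open>card K\<close> cannot vanish on all of K.
  Setting the functions to 0 outside K makes equality on K an equality of total functions.\<close>

lemma monomial_functions_independent:
  fixes K :: "'b::field set"
  assumes "finite K" "finite S" "\<And>n. n \<in> S \<Longrightarrow> n < card K"
  shows "fun_space.independent ((\<lambda>n x. if x \<in> K then x ^ n else 0) ` S)"
    and "inj_on (\<lambda>n (x::'b). if x \<in> K then x ^ n else 0) S"
proof -
  define g :: "nat \<Rightarrow> 'b \<Rightarrow> 'b" where "g n x = (if x \<in> K then x ^ n else 0)" for n x
  have zero: "c n = 0" if 0: "\<And>x. x \<in> K \<Longrightarrow> (\<Sum>n\<in>S. c n * x ^ n) = 0" and n: "n \<in> S" for c n
  proof -
    define p where "p = (\<Sum>n\<in>S. Polynomial.monom (c n) n)"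
    have "p = 0"
    proof (rule ccontr)
      assume "p \<noteq> 0"
      have "K \<subseteq> {x. poly p x = 0}" using 0 by (auto simp: p_def poly_sum poly_monom)
      then have "card K \<le> card {x. poly p x = 0}"
        using poly_roots_finite[OF \<open>p \<noteq> 0\<close>] card_mono by blast
      also have "\<dots> \<le> Polynomial.degree p" using card_poly_roots_bound[OF \<open>p \<noteq> 0\<close>] .
      also have "\<dots> < card K"
      proof (rule degree_lessI)
        show "p \<noteq> 0 \<or> card K > 0" using \<open>p \<noteq> 0\<close> by simp
        show "\<forall>k\<ge>card K. Polynomial.coeff p k = 0"
          using assms(3) by (auto simp: p_def coeff_sum intro!: sum.neutral) (metis linorder_not_less)
      qed
      finally show False by simp
    qed
    moreover have "Polynomial.coeff p n = c n"
      using n \<open>finite S\<close> by (simp add: p_def coeff_sum if_distrib[of c] sum.delta cong: if_cong)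
    ultimately show ?thesis by simp
  qed
  have inj: "inj_on g S"
  proof (rule inj_onI, rule ccontr)
    fix m n assume mn: "m \<in> S" "n \<in> S" "g m = g n" "m \<noteq> n"
    \<comment> \<open>Injectivity is the case of the relation x^m - x^n = 0.\<close>
    define c :: "nat \<Rightarrow> 'b" where "c k = (if k = m then 1 else 0) - (if k = n then 1 else 0)" for k
    have "c m = 0"
    proof (rule zero)
      fix x assume "x \<in> K"
      then have "x ^ m = x ^ n" using fun_cong[OF mn(3), of x] by (simp add: g_def)
      moreover have "(\<Sum>k\<in>S. c k * x ^ k) = x ^ m - x ^ n"
        using mn \<open>finite S\<close> by (simp add: c_def left_diff_distrib sum_subtractf if_distrib[of "\<lambda>a. a * _"] sum.delta' cong: if_cong)
      ultimately show "(\<Sum>k\<in>S. c k * x ^ k) = 0" by simp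
    qed (use mn in auto)
    then show False using mn by (simp add: c_def)
  qed
  have "fun_space.independent (g ` S)"
  proof (rule fun_space.independent_if_scalars_zero)
    fix u f assume sum: "(\<Sum>h\<in>g ` S. (\<lambda>x. u h * h x)) = 0" and "f \<in> g ` S"
    then obtain n where n: "n \<in> S" "f = g n" by blast
    have "u (g n) = 0"
    proof (rule zero[of "\<lambda>n. u (g n)"])
      fix x assume "x \<in> K"
      have "(\<Sum>h\<in>g ` S. (\<lambda>x. u h * h x)) x = 0" by (simp only: sum zero_fun_def)
      then have "(\<Sum>h\<in>g ` S. u h * h x) = 0" by (simp add: sum_fun_apply)
      then show "(\<Sum>n\<in>S. u (g n) * x ^ n) = 0"
        using \<open>x \<in> K\<close> by (simp add: sum.reindex[OF inj] g_def)
    qed (rule n)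
    then show "u f = 0" using n by simp
  qed (use \<open>finite S\<close> in simp)
  then show "fun_space.independent ((\<lambda>n x. if x \<in> K then x ^ n else 0) ` S)"
    and "inj_on (\<lambda>n (x::'b). if x \<in> K then x ^ n else 0) S"
    using inj by (simp_all add: g_def[abs_def])
qed

section \<open>The point set\<close>

abbreviation K6 :: "'a::{field,finite} alg_closure set" where "K6 \<equiv> frob.K6"
abbreviation point_vec :: "'a::{field,finite} alg_closure \<Rightarrow> 'a alg_closure \<times> 'a alg_closure \<times> 'a alg_closure"
  where "point_vec \<equiv> frob.point_vec"

lemma K6_mult: "x \<in> K6 \<Longrightarrow> y \<in> K6 \<Longrightarrow> x * y \<in> K6"
  and K6_divide: "x \<in> K6 \<Longrightarrow> y \<in> K6 \<Longrightarrow> x / y \<in> K6"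
  and K6_to_ac: "to_ac c \<in> K6"
  and K6_fixed3: "frob (frob (frob x)) = x \<Longrightarrow> x \<in> K6"
  by (simp_all add: frob.K6_def)

lemma card_K6: "card (K6 :: 'a::{field,finite} alg_closure set) = CARD('a) ^ 6"
proof -
  have "(K6 :: 'a alg_closure set) = {x. (frob ^^ 6) x = x}"
    by (simp add: frob.K6_def numeral_eq_Suc)
  then show ?thesis using card_fixed_frob[of 6, where 'a = 'a] by simp
qed

lemma finite_K6: "finite (K6 :: 'a::{field,finite} alg_closure set)"
  by (rule card_ge_0_finite) (simp add: card_K6 card_gt_0_iff)

lemma card_fixed_frob_2: "card {x :: 'a::{field,finite} alg_closure. frob (frob x) = x} = CARD('a) ^ 2"
  using card_fixed_frob[of 2, where 'a = 'a] by (simp add: numeral_eq_Suc)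

lemma card_fixed_frob_3: "card {x :: 'a::{field,finite} alg_closure. frob (frob (frob x)) = x} = CARD('a) ^ 3"
  using card_fixed_frob[of 3, where 'a = 'a] by (simp add: numeral_eq_Suc)

lemma card_image_eq_if_same_fibres:
  fixes f :: "'c \<Rightarrow> 'd" and g :: "'c \<Rightarrow> 'e"
  assumes "\<And>x y. x \<in> S \<Longrightarrow> y \<in> S \<Longrightarrow> f x = f y \<longleftrightarrow> g x = g y"
  shows "card (f ` S) = card (g ` S)"
proof -
  have "bij_betw (\<lambda>p. g (inv_into S f p)) (f ` S) (g ` S)"
  proof (rule bij_betwI[where g = "\<lambda>p. f (inv_into S g p)"])
    show "(\<lambda>p. g (inv_into S f p)) \<in> f ` S \<rightarrow> g ` S" "(\<lambda>p. f (inv_into S g p)) \<in> g ` S \<rightarrow> f ` S"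
      by (auto intro!: imageI inv_into_into)
    show "f (inv_into S g (g (inv_into S f p))) = p" if "p \<in> f ` S" for p
    proof -
      define y where "y = inv_into S f p"
      have y: "y \<in> S" "f y = p" unfolding y_def using that by (rule inv_into_into, rule f_inv_into_f)
      have "inv_into S g (g y) \<in> S" "g (inv_into S g (g y)) = g y"
        using y(1) by (auto intro: inv_into_into f_inv_into_f)
      then show ?thesis using assms y unfolding y_def by metis
    qed
    show "g (inv_into S f (f (inv_into S g p))) = p" if "p \<in> g ` S" for p
    proof -
      define y where "y = inv_into S g p"
      have y: "y \<in> S" "g y = p" unfolding y_def using that by (rule inv_into_into, rule f_inv_into_f)
      have "inv_into S f (f y) \<in> S" "f (inv_into S f (f y)) = f y"
        using y(1) by (auto intro: inv_into_into f_inv_into_f)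
      then show ?thesis using assms y unfolding y_def by metis
    qed
  qed
  then show ?thesis by (rule bij_betw_same_card)
qed

section \<open>The F_q-space of dimension 14 with its multiplicative action\<close>

definition ext_scale :: "'a::{field,finite} \<Rightarrow> 'a alg_closure \<times> 'a alg_closure \<times> 'a alg_closure
    \<Rightarrow> 'a alg_closure \<times> 'a alg_closure \<times> 'a alg_closure" where
  "ext_scale c v = (to_ac c * fst v, to_ac c * fst (snd v), to_ac c * snd (snd v))"

interpretation ext: vector_space "ext_scale :: 'a::{field,finite} \<Rightarrow> _"
  by unfold_locales (auto simp: ext_scale_def prod_eq_iff algebra_simps)

definition ext_space :: "('a::{field,finite} alg_closure \<times> 'a alg_closure \<times> 'a alg_closure) set" where
  "ext_space = K6 \<times> K6 \<times> {x. frob (frob x) = x}"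

lemma subspace_ext_space: "ext.subspace (ext_space :: ('a::{field,finite} alg_closure \<times> _) set)"
  by (auto simp: ext.subspace_def ext_space_def ext_scale_def frob.K6_def zero_prod_def)

lemma card_ext_space: "card (ext_space :: ('a::{field,finite} alg_closure \<times> _) set) = CARD('a) ^ 14"
  by (simp add: ext_space_def card_cartesian_product card_K6 card_fixed_frob_2 flip: power_add)

lemma point_vec_in_ext_space:
  assumes "x \<in> K6"
  shows "point_vec x \<in> ext_space"
  using assms by (simp add: ext_space_def frob.point_vec_def frob.K6_def mult_ac)

text \<open>The quotient x/y is fixed by \<open>frob\<close> and so belongs to F_q. Thus
  \<open>frob x / x\<close> labels the class of x modulo scalars and serves as the name of a
  point.\<close>

lemma frob_ratio_eq:
  assumes "frob x / x = frob y / y" "x \<noteq> 0" "y \<noteq> 0"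
  obtains c where "c \<noteq> 0" "x = to_ac c * y"
proof -
  have "frob x * y = frob y * x" using assms by (simp add: frac_eq_eq)
  then have "frob (x / y) = x / y" using assms(3) by (simp add: frac_eq_eq mult.commute)
  then obtain c where c: "x / y = to_ac c" by (rule obtain_to_ac)
  then have "x = to_ac c * y" using assms(3) by (metis nonzero_divide_eq_eq)
  moreover from this have "c \<noteq> 0" using assms(2) by auto
  ultimately show thesis using that by blast
qed

lemma point_vec_to_ac_mult: "point_vec (to_ac c * x) = ext_scale (c ^ 3) (point_vec x)"
  by (simp add: frob.point_vec_def ext_scale_def power3_eq_cube mult_ac)

definition ext_mult :: "'a::{field,finite} alg_closure \<Rightarrow> 'a alg_closure \<times> 'a alg_closure \<times> 'a alg_closure
    \<Rightarrow> 'a alg_closure \<times> 'a alg_closure \<times> 'a alg_closure" where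
  "ext_mult y v = (fst (point_vec y) * fst v, fst (snd (point_vec y)) * fst (snd v), snd (snd (point_vec y)) * snd (snd v))"

lemma ext_mult_point_vec: "ext_mult y (point_vec x) = point_vec (y * x)"
  by (simp add: ext_mult_def frob.point_vec_def mult_ac)

lemma ext_mult_ext_mult: "ext_mult y (ext_mult z v) = ext_mult (y * z) v"
  by (simp add: ext_mult_def frob.point_vec_def mult_ac)

lemma ext_mult_1: "ext_mult 1 v = v"
  by (simp add: ext_mult_def frob.point_vec_def)

lemma ext_mult_in_ext_space:
  assumes "y \<in> K6" "v \<in> ext_space"
  shows "ext_mult y v \<in> ext_space"
proof -
  have "fst (point_vec y) \<in> K6" "fst (snd (point_vec y)) \<in> K6"
    "frob (frob (snd (snd (point_vec y)))) = snd (snd (point_vec y))"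
    using point_vec_in_ext_space[OF assms(1)] by (auto simp: ext_space_def mem_Times_iff)
  then show ?thesis using assms(2) by (auto simp: ext_mult_def ext_space_def mem_Times_iff K6_mult)
qed

text \<open>Any F_q-linear identification will do: all facts about vectors of length 14 are pulled
  back through the injective map \<Psi>.\<close>

locale ext_coordinates =
  fixes \<Psi> :: "'a::{field,finite} ^ 14 \<Rightarrow> 'a alg_closure \<times> 'a alg_closure \<times> 'a alg_closure"
  assumes \<Psi>_add: "\<Psi> (x + y) = \<Psi> x + \<Psi> y"
    and \<Psi>_scale: "\<Psi> (c *s x) = ext_scale c (\<Psi> x)"
    and inj_\<Psi>: "inj \<Psi>"
    and range_\<Psi>: "range \<Psi> = ext_space"

lemma ext_coordinates_exist:
  obtains \<Psi> :: "'a::{field,finite} ^ 14 \<Rightarrow> 'a alg_closure \<times> 'a alg_closure \<times> 'a alg_closure"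
  where "ext_coordinates \<Psi>"
proof -
  have "finite (ext_space :: ('a alg_closure \<times> _) set)"
    by (rule card_ge_0_finite) (simp add: card_ext_space card_gt_0_iff)
  from ext.coordinates_exist[OF subspace_ext_space this, where 'n = 14] show thesis
  proof this
    show "card (ext_space :: ('a alg_closure \<times> _) set) = CARD('a) ^ CARD(14)" by (simp add: card_ext_space)
    show "1 < CARD('a)" by (rule card_field_gt_1)
  next
    fix \<Psi> :: "'a ^ 14 \<Rightarrow> 'a alg_closure \<times> 'a alg_closure \<times> 'a alg_closure"
    assume "\<And>x y. \<Psi> (x + y) = \<Psi> x + \<Psi> y" "\<And>c x. \<Psi> (c *s x) = ext_scale c (\<Psi> x)"
      "inj \<Psi>" "range \<Psi> = ext_space"
    then have "ext_coordinates \<Psi>" by unfold_locales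
    then show thesis by (rule that)
  qed
qed

context ext_coordinates
begin

lemma \<Psi>_0: "\<Psi> 0 = 0"
  using \<Psi>_add[of 0 0] by simp

lemma \<Psi>_sum: "\<Psi> (\<Sum>i\<in>I. f i) = (\<Sum>i\<in>I. \<Psi> (f i))"
  by (induction I rule: infinite_finite_induct) (simp_all add: \<Psi>_0 \<Psi>_add)

definition pvec :: "'a alg_closure \<Rightarrow> 'a ^ 14" where
  "pvec x = inv_into UNIV \<Psi> (point_vec x)"

definition pnt :: "'a alg_closure \<Rightarrow> ('a ^ 14) set" where
  "pnt x = vec.span {pvec x}"

definition pset :: "('a ^ 14) set set" where
  "pset = pnt ` (K6 - {0})"

lemma \<Psi>_inv: "v \<in> ext_space \<Longrightarrow> \<Psi> (inv_into UNIV \<Psi> v) = v"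
  by (simp add: f_inv_into_f range_\<Psi>)

lemma \<Psi>_pvec: "x \<in> K6 \<Longrightarrow> \<Psi> (pvec x) = point_vec x"
  unfolding pvec_def by (rule \<Psi>_inv[OF point_vec_in_ext_space])

lemma pvec_scalars_zero:
  assumes T: "T \<subseteq> K6 - {0}" "finite T" "card T \<le> 4" "inj_on (\<lambda>x. frob x / x) T"
    and sum: "(\<Sum>x\<in>T. c x *s pvec x) = 0" and "x \<in> T"
  shows "c x = 0"
proof (rule ccontr)
  assume "c x \<noteq> 0"
  \<comment> \<open>Passing to the support meets the demand of \<open>point_vec_independent\<close>
    for nonzero weights.\<close>
  define I where "I = {x \<in> T. c x \<noteq> 0}"
  have "(\<Sum>x\<in>T. ext_scale (c x) (point_vec x)) = \<Psi> (\<Sum>x\<in>T. c x *s pvec x)"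
    unfolding \<Psi>_sum \<Psi>_scale using T(1) by (intro sum.cong) (auto simp: \<Psi>_pvec)
  also have "\<dots> = 0" by (simp add: sum \<Psi>_0)
  finally have 0: "(\<Sum>x\<in>T. ext_scale (c x) (point_vec x)) = 0" .
  have "(\<Sum>x\<in>I. ext_scale (c x) (point_vec x)) = (\<Sum>x\<in>T. ext_scale (c x) (point_vec x))"
    unfolding I_def using T(2) by (intro sum.mono_neutral_left) auto
  then have 0: "(\<Sum>x\<in>I. ext_scale (c x) (point_vec x)) = 0" using 0 by simp
  show False
  proof (rule frob.point_vec_independent[of I "\<lambda>x. x" "\<lambda>x. to_ac (c x)"])
    show "finite I" "I \<noteq> {}" using T(2) \<open>x \<in> T\<close> \<open>c x \<noteq> 0\<close> by (auto simp: I_def)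
    have "I \<subseteq> T" by (auto simp: I_def)
    then show "card I \<le> 4" "inj_on (\<lambda>i. frob i / i) I"
      using T card_mono[of T I] inj_on_subset by (force, blast)
    show "(\<Sum>i\<in>I. to_ac (c i) * fst (point_vec i)) = 0"
      using arg_cong[OF 0, of fst] by (simp add: fst_sum ext_scale_def)
    show "(\<Sum>i\<in>I. to_ac (c i) * fst (snd (point_vec i))) = 0"
      using arg_cong[OF 0, of "\<lambda>v. fst (snd v)"] by (simp add: fst_sum snd_sum ext_scale_def)
    show "(\<Sum>i\<in>I. to_ac (c i) * snd (snd (point_vec i))) = 0"
      using arg_cong[OF 0, of "\<lambda>v. snd (snd v)"] by (simp add: snd_sum ext_scale_def)
  qed (use T(1) in \<open>auto simp: I_def\<close>)
qed

lemma pvec_inj: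
  assumes "x \<in> K6 - {0}" "y \<in> K6 - {0}" "frob x / x \<noteq> frob y / y"
  shows "pvec x \<noteq> pvec y"
proof
  assume eq: "pvec x = pvec y"
  have "x \<noteq> y" using assms(3) by auto
  then have "(\<Sum>z\<in>{x, y}. (if z = x then 1 else - 1) *s pvec z) = 0"
    by (simp add: eq)
  from pvec_scalars_zero[OF _ _ _ _ this, of x] show False
    using assms \<open>x \<noteq> y\<close> by (auto simp: inj_on_def)
qed

lemma pvec_independent:
  assumes T: "T \<subseteq> K6 - {0}" "finite T" "card T \<le> 4" "inj_on (\<lambda>x. frob x / x) T"
  shows "inj_on pvec T" "vec.independent (pvec ` T)"
proof -
  show inj: "inj_on pvec T"
    using T pvec_inj by (smt (verit, best) inj_on_def subsetD)
  show "vec.independent (pvec ` T)"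
  proof (rule vec.independent_if_scalars_zero)
    fix f v assume sum: "(\<Sum>v\<in>pvec ` T. f v *s v) = 0" and "v \<in> pvec ` T"
    then obtain x where x: "x \<in> T" "v = pvec x" by blast
    have "(\<Sum>x\<in>T. f (pvec x) *s pvec x) = 0" using sum by (simp add: sum.reindex[OF inj])
    from pvec_scalars_zero[OF T this x(1)] show "f v = 0" by (simp add: x(2))
  qed (use T in simp)
qed

text \<open>A factor c from F_q multiplies the vector by c^3 and keeps its span; different ratios
  give independent vectors by the case of two points.\<close>

lemma pnt_eq_iff:
  assumes "x \<in> K6 - {0}" "y \<in> K6 - {0}"
  shows "pnt x = pnt y \<longleftrightarrow> frob x / x = frob y / y"
proof
  assume eq: "pnt x = pnt y"
  show "frob x / x = frob y / y"
  proof (rule ccontr)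
    assume neq: "frob x / x \<noteq> frob y / y"
    then have "x \<noteq> y" by auto
    have ind: "vec.independent (pvec ` {x, y})"
      by (rule pvec_independent) (use assms neq \<open>x \<noteq> y\<close> in \<open>auto simp: inj_on_def\<close>)
    have "pvec x \<in> vec.span {pvec y}" using eq unfolding pnt_def by (metis insertI1 vec.span_base)
    moreover have "{pvec x, pvec y} - {pvec x} = {pvec y}" using pvec_inj[OF assms neq] by auto
    ultimately have "vec.dependent {pvec x, pvec y}" unfolding vec.dependent_def by auto
    then show False using ind by simp
  qed
next
  assume "frob x / x = frob y / y"
  then obtain c where c: "c \<noteq> 0" "x = to_ac c * y" using assms frob_ratio_eq[of x y] by blast
  have "\<Psi> (pvec x) = \<Psi> ((c ^ 3) *s pvec y)"
    unfolding \<Psi>_scale using assms by (simp add: \<Psi>_pvec c(2) point_vec_to_ac_mult)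
  then have "pvec x = (c ^ 3) *s pvec y" using inj_\<Psi> by (simp add: inj_def)
  then show "pnt x = pnt y"
    unfolding pnt_def using vec.span_image_scale[of "{pvec y}" "\<lambda>_. c ^ 3"] c(1) by simp
qed

lemma pvec_nonzero:
  assumes "x \<in> K6 - {0}"
  shows "pvec x \<noteq> 0"
  using pvec_independent(2)[of "{x}"] assms vec.dependent_zero by auto

text \<open>Points correspond to values of \<open>frob x / x\<close>, and each fibre of this map on
  the nonzero elements is a coset of the multiplicative group of F_q.\<close>

lemma card_pset: "card pset * (CARD('a) - 1) = CARD('a) ^ 6 - 1"
proof -
  define S where "S = K6 - {0 :: 'a alg_closure}"
  define r where "r x = frob x / x" for x :: "'a alg_closure"
  have fin: "finite S" by (simp add: S_def finite_K6)
  have "card pset = card (r ` S)"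
    unfolding pset_def S_def[symmetric]
    by (rule card_image_eq_if_same_fibres) (use pnt_eq_iff in \<open>simp add: S_def r_def\<close>)
  moreover have "card {x \<in> S. r x = y} = CARD('a) - 1" if "y \<in> r ` S" for y
  proof -
    obtain x where x: "x \<in> S" "y = r x" using \<open>y \<in> r ` S\<close> by blast
    have nz: "x \<noteq> 0" using x by (simp add: S_def)
    have "{x' \<in> S. r x' = y} = (\<lambda>c. to_ac c * x) ` (UNIV - {0})"
    proof
      show "{x' \<in> S. r x' = y} \<subseteq> (\<lambda>c. to_ac c * x) ` (UNIV - {0})"
      proof clarify
        fix x' assume "x' \<in> S" "y = r x'"
        then obtain c where "c \<noteq> 0" "x' = to_ac c * x"
          using frob_ratio_eq[of x' x] x nz by (auto simp: r_def S_def)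
        then show "x' \<in> (\<lambda>c. to_ac c * x) ` (UNIV - {0})" by blast
      qed
      show "(\<lambda>c. to_ac c * x) ` (UNIV - {0}) \<subseteq> {x' \<in> S. r x' = y}"
        using x nz by (auto simp: S_def r_def K6_mult K6_to_ac)
    qed
    moreover have "inj_on (\<lambda>c. to_ac c * x) (UNIV - {0})" using nz by (simp add: inj_on_def)
    ultimately show ?thesis by (simp add: card_image)
  qed
  moreover have "card S = (\<Sum>y\<in>r ` S. card {x \<in> S. r x = y})"
    using sum.image_gen[OF fin, of "\<lambda>_. 1::nat" r] by simp
  ultimately have "card S = card pset * (CARD('a) - 1)" by simp
  moreover have "card S = CARD('a) ^ 6 - 1"
    unfolding S_def using card_Diff_singleton[of 0 "K6 :: 'a alg_closure set"]
    by (simp add: card_K6 K6_fixed3)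
  ultimately show ?thesis by simp
qed

lemma pset_subset_proj_points: "pset \<subseteq> proj_points"
proof
  fix p assume "p \<in> pset"
  then obtain x where x: "x \<in> K6 - {0}" "p = pnt x" by (auto simp: pset_def)
  have "vec.independent {pvec x}" using pvec_nonzero[OF x(1)] by simp
  then have "vec.dim p = 1" unfolding x(2) pnt_def by (simp add: vec.dim_span_eq_card_independent)
  then show "p \<in> proj_points" by (simp add: proj_points_def proj_subspaces_def x(2) pnt_def)
qed

lemma pnt_subset_iff:
  assumes "vec.subspace W"
  shows "pnt x \<subseteq> W \<longleftrightarrow> pvec x \<in> W"
  unfolding pnt_def using assms
  by (metis empty_subsetI insert_subset vec.span_minimal vec.span_superset subset_trans)

lemma card_pts_in_plane:
  assumes W: "W \<in> proj_subspaces 2"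
  shows "card (pts_in pset W) \<le> 3"
proof (rule ccontr)
  assume "\<not> card (pts_in pset W) \<le> 3"
  then obtain P where P: "P \<subseteq> pts_in pset W" "card P = 4" "finite P"
    using obtain_subset_with_card_n[of 4 "pts_in pset W"] by auto
  have "\<forall>p\<in>P. \<exists>x. x \<in> K6 - {0} \<and> pnt x = p" using P(1) by (auto simp: pts_in_def pset_def)
  then obtain g where g: "\<And>p. p \<in> P \<Longrightarrow> g p \<in> K6 - {0} \<and> pnt (g p) = p" by metis
  have inj: "inj_on g P" using g by (metis inj_onI)
  have "inj_on (\<lambda>x. frob x / x) (g ` P)"
    using g pnt_eq_iff by (smt (verit, best) image_iff inj_on_def)
  moreover have "g ` P \<subseteq> K6 - {0}" using g by auto
  moreover have "card (g ` P) = 4" using inj P(2) by (simp add: card_image)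
  ultimately have ind: "inj_on pvec (g ` P)" "vec.independent (pvec ` g ` P)"
    using pvec_independent[of "g ` P"] P(3) by auto
  have "pvec ` g ` P \<subseteq> W"
  proof clarify
    fix p assume "p \<in> P"
    then have "pnt (g p) \<subseteq> W" using P(1) g by (auto simp: pts_in_def)
    then show "pvec (g p) \<in> W" using W pnt_subset_iff[of W] by (simp add: proj_subspaces_def)
  qed
  from vec.independent_card_le_dim[OF this ind(2)] show False
    using W \<open>card (g ` P) = 4\<close> ind(1) by (simp add: card_image proj_subspaces_def)
qed

end

section \<open>Monomials in the conjugates as functionals\<close>

lemma prod_funpow_frob: "(\<Prod>i\<in>T. (frob ^^ i) x) = x ^ (\<Sum>i\<in>T. CARD('a) ^ i)"
  for x :: "'a::{field,finite} alg_closure"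
  by (simp add: funpow_frob power_sum)

text \<open>\<open>\<phi>\<close> is an F_q-linear functional with values in F_(q^6) whose value on the vector of x is the monomial with
  exponent set T in the conjugates of x.\<close>

definition monomial_functional :: "nat set \<Rightarrow> ('a::{field,finite} alg_closure \<times> 'a alg_closure \<times> 'a alg_closure \<Rightarrow> 'a alg_closure) \<Rightarrow> bool" where
  "monomial_functional T \<phi> \<longleftrightarrow> T \<subseteq> {..<6} \<and> (\<forall>u v. \<phi> (u + v) = \<phi> u + \<phi> v) \<and>
     (\<forall>c v. \<phi> (ext_scale c v) = to_ac c * \<phi> v) \<and> (\<forall>x\<in>K6. \<phi> (point_vec x) = (\<Prod>i\<in>T. (frob ^^ i) x))"

text \<open>Composition with \<open>frob\<close> preserves F_q-linearity because \<open>frob\<close>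
  fixes F_q, and the indices are taken modulo 6 because the sixth conjugate of x is x.\<close>

lemma monomial_functional_shift:
  assumes "monomial_functional T \<phi>"
  shows "monomial_functional ((\<lambda>i. Suc i mod 6) ` T) (\<lambda>v. frob (\<phi> v))"
proof -
  have "frob (\<phi> (point_vec x)) = (\<Prod>i\<in>(\<lambda>i. Suc i mod 6) ` T. (frob ^^ i) x)" if x: "x \<in> K6" for x
  proof -
    have inj: "inj_on (\<lambda>i. Suc i mod 6) T"
    proof (rule inj_onI)
      fix i j assume "i \<in> T" "j \<in> T" "Suc i mod 6 = Suc j mod 6"
      moreover have "Suc k mod 6 = (if k = 5 then 0 else Suc k)" if "k \<in> T" for k
      proof -
        have "k < 6" using assms that by (auto simp: monomial_functional_def)
        then show ?thesis by auto
      qed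
      ultimately show "i = j" by (metis Suc_inject nat.distinct(1))
    qed
    have eq: "(frob ^^ Suc i) x = (frob ^^ (Suc i mod 6)) x" if "i \<in> T" for i
    proof (cases "i = 5")
      case True
      then show ?thesis using x by (simp add: frob.K6_def numeral_eq_Suc)
    next
      case False
      moreover have "i < 6" using assms that by (auto simp: monomial_functional_def)
      ultimately have "Suc i < 6" by linarith
      then show ?thesis by simp
    qed
    have "frob (\<phi> (point_vec x)) = (\<Prod>i\<in>T. (frob ^^ Suc i) x)"
      using assms x by (simp add: monomial_functional_def)
    also have "\<dots> = (\<Prod>i\<in>T. (frob ^^ (Suc i mod 6)) x)"
      by (intro prod.cong refl eq)
    finally show ?thesis by (simp add: prod.reindex[OF inj])
  qed
  then show ?thesis using assms by (auto simp: monomial_functional_def)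
qed

lemma monomial_functional_base:
  "monomial_functional {0, 1, 3} fst" "monomial_functional {0, 2, 3} (\<lambda>v. fst (snd v))"
  "monomial_functional {0, 2, 4} (\<lambda>v. snd (snd v))"
  by (simp_all add: monomial_functional_def ext_scale_def frob.point_vec_def numeral_eq_Suc mult_ac)

text \<open>The orbits of {0,1,3}, {0,2,3} and {0,2,4} under the cyclic shift, of lengths 6, 6 and
  2.\<close>

definition exponent_sets :: "nat set set" where
  "exponent_sets = {{0,1,3}, {1,2,4}, {2,3,5}, {3,4,0}, {4,5,1}, {5,0,2},
     {0,2,3}, {1,3,4}, {2,4,5}, {3,5,0}, {4,0,1}, {5,1,2}, {0,2,4}, {1,3,5}}"

lemma exponent_sets_functional:
  assumes "T \<in> exponent_sets"
  shows "\<exists>\<phi>. monomial_functional T (\<phi> :: 'a::{field,finite} alg_closure \<times> 'a alg_closure \<times> 'a alg_closure \<Rightarrow> _)"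
proof -
  define good where "good T \<longleftrightarrow> (\<exists>\<phi>. monomial_functional T (\<phi> :: 'a alg_closure \<times> 'a alg_closure \<times> 'a alg_closure \<Rightarrow> _))" for T
  have shift: "good ((\<lambda>i. (i + 1) mod 6) ` T)" if "good T" for T
    using that monomial_functional_shift unfolding good_def Suc_eq_plus1[symmetric] by blast
  have a0: "good {0,1,3}" and b0: "good {0,2,3}" and c0: "good {0,2,4}"
    using monomial_functional_base unfolding good_def by blast+
  have a1: "good {1,2,4}" using shift[OF a0] by (simp del: One_nat_def)
  have a2: "good {2,3,5}" using shift[OF a1] by (simp del: One_nat_def)
  have a3: "good {3,4,0}" using shift[OF a2] by (simp del: One_nat_def)
  have a4: "good {4,5,1}" using shift[OF a3] by (simp del: One_nat_def)
  have a5: "good {5,0,2}" using shift[OF a4] by (simp del: One_nat_def)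
  have b1: "good {1,3,4}" using shift[OF b0] by (simp del: One_nat_def)
  have b2: "good {2,4,5}" using shift[OF b1] by (simp del: One_nat_def)
  have b3: "good {3,5,0}" using shift[OF b2] by (simp del: One_nat_def)
  have b4: "good {4,0,1}" using shift[OF b3] by (simp del: One_nat_def)
  have b5: "good {5,1,2}" using shift[OF b4] by (simp del: One_nat_def)
  have c1: "good {1,3,5}" using shift[OF c0] by (simp del: One_nat_def)
  have "good T"
    using assms a0 a1 a2 a3 a4 a5 b0 b1 b2 b3 b4 b5 c0 c1 unfolding exponent_sets_def by blast
  then show ?thesis unfolding good_def .
qed

lemma card_exponent_sets: "card exponent_sets \<ge> 14"
proof -
  \<comment> \<open>Binary codes reduce the distinctness of the sets to that of fourteen
    numbers.\<close>
  have "(\<lambda>T. \<Sum>i\<in>T. 2 ^ i :: nat) ` exponent_sets = {11, 22, 44, 25, 50, 37, 13, 26, 52, 41, 19, 38, 21, 42}"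
    by (simp add: exponent_sets_def)
  then have "card ((\<lambda>T. \<Sum>i\<in>T. 2 ^ i :: nat) ` exponent_sets) = 14" by simp
  moreover have "finite exponent_sets" by (simp add: exponent_sets_def)
  ultimately show ?thesis using card_image_le by metis
qed

section \<open>Auxiliary elements of F_(q^2) and F_(q^3)\<close>

lemma quadratic_has_root: "\<exists>t. t * t - b * t + c = (0 :: 'a::alg_closed_field)"
proof -
  have "\<exists>t. poly [:c, - b, 1:] t = 0" by (rule alg_closed_imp_poly_has_root) simp
  then show ?thesis by (simp add: algebra_simps)
qed

text \<open>An element outside F_q is divided by its trace. If the trace is zero, the conjugate is
  the negative and differs from the element, so 2 is nonzero; adding 1 then makes the trace equal to
  2.\<close>

lemma exists_quadratic_trace_1:
  obtains \<eta> :: "'a::{field,finite} alg_closure" where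
    "frob (frob \<eta>) = \<eta>" "\<eta> + frob \<eta> = 1" "frob \<eta> \<noteq> \<eta>"
proof -
  have "card {x :: 'a alg_closure. frob x = x} < card {x :: 'a alg_closure. frob (frob x) = x}"
    using card_fixed_frob[of 1, where 'a = 'a] card_field_gt_1[where 'a = 'a]
    by (simp add: card_fixed_frob_2 power2_eq_square)
  moreover have "{x :: 'a alg_closure. frob x = x} \<subseteq> {x. frob (frob x) = x}" by auto
  ultimately obtain \<delta> :: "'a alg_closure" where \<delta>: "frob (frob \<delta>) = \<delta>" "frob \<delta> \<noteq> \<delta>"
    by (metis (mono_tags, lifting) less_irrefl mem_Collect_eq subsetI subset_antisym)
  note result = that
  have main: thesis if "frob (frob d) = d" "frob d \<noteq> d" "d + frob d \<noteq> 0" for d :: "'a alg_closure"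
  proof (rule result[of "d / (d + frob d)"])
    have "frob (d / (d + frob d)) = frob d / (d + frob d)"
      by (simp add: \<open>frob (frob d) = d\<close> add.commute)
    then show "frob (frob (d / (d + frob d))) = d / (d + frob d)"
      "d / (d + frob d) + frob (d / (d + frob d)) = 1" "frob (d / (d + frob d)) \<noteq> d / (d + frob d)"
      using \<open>frob (frob d) = d\<close> \<open>d + frob d \<noteq> 0\<close> \<open>frob d \<noteq> d\<close>
      by (simp_all add: add.commute flip: add_divide_distrib)
  qed
  show thesis
  proof (cases "\<delta> + frob \<delta> = 0")
    case False
    then show thesis using main \<delta> by blast
  next
    case True
    have "(2 :: 'a alg_closure) \<noteq> 0"
    proof
      assume "(2 :: 'a alg_closure) = 0"
      have "\<delta> + \<delta> = 2 * \<delta>" by simp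
      also have "\<dots> = 0" by (simp only: \<open>2 = 0\<close> mult_zero_left)
      finally have "\<delta> + \<delta> = \<delta> + frob \<delta>" by (simp add: True)
      then show False using \<delta>(2) by simp
    qed
    moreover have "(\<delta> + 1) + frob (\<delta> + 1) = (\<delta> + frob \<delta>) + 2" by simp
    ultimately show thesis using main[of "\<delta> + 1"] \<delta> True by simp
  qed
qed

text \<open>The elements to avoid satisfy e e_2 = e_1^2 and are roots of X^(q^2+1) - X^(2q), whose
  degree is less than q^3. Zero is among these roots.\<close>

lemma exists_cubic_generator:
  obtains e :: "'a::{field,finite} alg_closure" where
    "frob (frob (frob e)) = e" "e \<noteq> 0" "frob (frob e / e) \<noteq> frob e / e"
proof -
  define q where "q = CARD('a)"
  have q: "1 < q" unfolding q_def by (rule card_field_gt_1)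
  define p :: "'a alg_closure poly" where "p = Polynomial.monom 1 (q\<^sup>2 + 1) - Polynomial.monom 1 (2 * q)"
  have lt: "2 * q < q\<^sup>2 + 1"
  proof -
    have "2 * q \<le> q * q" using q by (intro mult_right_mono) auto
    then show ?thesis unfolding power2_eq_square by linarith
  qed
  have "Polynomial.coeff p (q\<^sup>2 + 1) = 1" using lt by (simp add: p_def)
  then have "p \<noteq> 0" by auto
  have "Polynomial.degree p \<le> q\<^sup>2 + 1"
    unfolding p_def using lt by (intro degree_diff_le order_trans[OF degree_monom_le]) auto
  moreover have "q\<^sup>2 + 1 < q ^ 3"
  proof -
    have "1 < q\<^sup>2" using q by (intro one_less_power) auto
    then have "q\<^sup>2 + 1 < q\<^sup>2 * 2" by linarith
    also have "\<dots> \<le> q\<^sup>2 * q" using q by (intro mult_left_mono) auto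
    finally show ?thesis by (simp add: power2_eq_square power3_eq_cube)
  qed
  ultimately have "card {x. poly p x = 0} < q ^ 3"
    using card_poly_roots_bound[OF \<open>p \<noteq> 0\<close>] by linarith
  then have "\<not> {x. frob (frob (frob x)) = x} \<subseteq> {x. poly p x = 0}"
    using card_mono[OF poly_roots_finite[OF \<open>p \<noteq> 0\<close>], of "{x. frob (frob (frob x)) = x}"]
    by (auto simp: card_fixed_frob_3 q_def)
  then obtain e where e: "frob (frob (frob e)) = e" "poly p e \<noteq> 0" by blast
  have ff: "frob (frob e) * e = e ^ (q\<^sup>2 + 1)" "frob e * frob e = e ^ (2 * q)"
    using funpow_frob[of 2 e] by (simp_all add: frob_def q_def mult_2 power_add numeral_eq_Suc mult.commute)
  have "e \<noteq> 0"
  proof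
    assume "e = 0"
    then show False using e(2) q by (simp add: p_def poly_monom zero_power)
  qed
  moreover have "frob (frob e / e) \<noteq> frob e / e"
  proof
    assume "frob (frob e / e) = frob e / e"
    then have "frob (frob e) * e = frob e * frob e"
      using \<open>e \<noteq> 0\<close> by (simp add: frac_eq_eq)
    then show False using e(2) unfolding ff by (simp add: p_def poly_monom)
  qed
  ultimately show thesis using that e(1) by blast
qed

context ext_coordinates
begin

text \<open>Over a basis B of the span, x -> v(x) has coordinate functions \<open>h w\<close>, one
  for each w in B. Every functional applied to v(x) is a combination of them, so the 14 independent
  monomial functions lie in the span of \<open>card B\<close> functions.\<close>

lemma span_pset: "vec.span (\<Union>pset) = UNIV"
proof -
  define U where "U = vec.span (\<Union>pset)"
  obtain B where B: "B \<subseteq> U" "vec.independent B" "U \<subseteq> vec.span B" "card B = vec.dim U"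
    using vec.basis_exists by blast
  have finB: "finite B" using B(2) by (rule vec.finiteI_independent)
  have "\<exists>u. point_vec x = (\<Sum>w\<in>B. ext_scale (u w) (\<Psi> w))" if x: "x \<in> K6" for x
  proof -
    \<comment> \<open>Zero is included, although it gives no point, because the monomials are
      compared on all q^6 elements of \<open>K6\<close>.\<close>
    have "pvec x \<in> U"
    proof (cases "x = 0")
      case True
      then have "\<Psi> (pvec x) = \<Psi> 0" using x by (simp add: \<Psi>_pvec \<Psi>_0 frob.point_vec_def zero_prod_def)
      then have "pvec x = 0" using inj_\<Psi> by (simp add: inj_def)
      then show ?thesis by (simp add: U_def vec.span_zero)
    next
      case False
      have "pvec x \<in> pnt x" by (simp add: pnt_def vec.span_base)
      moreover have "pnt x \<in> pset" using x False by (simp add: pset_def)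
      ultimately show ?thesis unfolding U_def by (intro vec.span_base) auto
    qed
    then have "pvec x \<in> vec.span B" using B(3) by blast
    then obtain u where u: "pvec x = (\<Sum>w\<in>B. u w *s w)" unfolding vec.span_finite[OF finB] by auto
    have "point_vec x = \<Psi> (pvec x)" using x by (simp add: \<Psi>_pvec)
    also have "\<dots> = (\<Sum>w\<in>B. ext_scale (u w) (\<Psi> w))" unfolding u \<Psi>_sum \<Psi>_scale ..
    finally show ?thesis by blast
  qed
  then obtain u where u: "\<And>x. x \<in> K6 \<Longrightarrow> point_vec x = (\<Sum>w\<in>B. ext_scale (u x w) (\<Psi> w))" by metis
  define h where "h w x = (if x \<in> K6 then to_ac (u x w) else 0)" for w x
  define S where "S = (\<lambda>T. \<Sum>i\<in>T. CARD('a) ^ i) ` exponent_sets"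
  have sub: "exponent_sets \<subseteq> {T. T \<subseteq> {..<6}}" by (auto simp: exponent_sets_def)
  have finT: "finite exponent_sets" by (simp add: exponent_sets_def)
  have "inj_on (\<lambda>T. \<Sum>i\<in>T. CARD('a) ^ i) exponent_sets"
    using inj_on_sum_powers[OF card_field_gt_1] sub by (rule inj_on_subset)
  then have cardS: "card S \<ge> 14" using card_exponent_sets by (simp add: S_def card_image)
  have finS: "finite S" using finT by (simp add: S_def)
  have lt: "n < card (K6 :: 'a alg_closure set)" if n: "n \<in> S" for n
  proof -
    obtain T where T: "T \<in> exponent_sets" "n = (\<Sum>i\<in>T. CARD('a) ^ i)" using n by (auto simp: S_def)
    then have "T \<subseteq> {..<6}" using sub by blast
    then show ?thesis unfolding T(2) card_K6
      using finite_subset[of T "{..<6}"] card_field_gt_1 by (intro sum_powers_less) auto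
  qed
  define g where "g n x = (if x \<in> K6 then x ^ n else 0)" for n and x :: "'a alg_closure"
  have ind: "fun_space.independent (g ` S)" "inj_on g S"
    using monomial_functions_independent[OF finite_K6 finS lt] by (simp_all add: g_def[abs_def])
  have "g n \<in> fun_space.span (h ` B)" if n: "n \<in> S" for n
  proof -
    obtain T where T: "T \<in> exponent_sets" "n = (\<Sum>i\<in>T. CARD('a) ^ i)" using n by (auto simp: S_def)
    obtain \<phi> :: "'a alg_closure \<times> 'a alg_closure \<times> 'a alg_closure \<Rightarrow> 'a alg_closure"
      where \<phi>: "monomial_functional T \<phi>" using exponent_sets_functional[OF T(1)] by blast
    have add: "\<phi> (a + b) = \<phi> a + \<phi> b" and sc: "\<phi> (ext_scale c a) = to_ac c * \<phi> a" for a b c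
      using \<phi> unfolding monomial_functional_def by blast+
    have zero: "\<phi> 0 = 0" using add[of 0 0] by (metis add_0 add_cancel_right_right)
    have sum: "\<phi> (\<Sum>w\<in>B. f w) = (\<Sum>w\<in>B. \<phi> (f w))" for f
      using finB by (induction B) (simp_all add: zero add)
    have "g n = (\<Sum>w\<in>B. (\<lambda>x. \<phi> (\<Psi> w) * h w x))"
    proof
      fix x
      show "g n x = (\<Sum>w\<in>B. (\<lambda>x. \<phi> (\<Psi> w) * h w x)) x"
      proof (cases "x \<in> K6")
        case True
        then have "g n x = \<phi> (point_vec x)"
          using \<phi> by (simp add: g_def T(2) monomial_functional_def prod_funpow_frob)
        also have "\<dots> = (\<Sum>w\<in>B. to_ac (u x w) * \<phi> (\<Psi> w))" by (simp only: u[OF True] sum sc)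
        also have "\<dots> = (\<Sum>w\<in>B. \<phi> (\<Psi> w) * h w x)" using True by (simp add: h_def mult.commute)
        finally show ?thesis by (simp add: sum_fun_apply)
      next
        case False
        then show ?thesis by (simp add: g_def h_def sum_fun_apply)
      qed
    qed
    also have "\<dots> \<in> fun_space.span (h ` B)"
      by (intro fun_space.span_sum fun_space.span_scale fun_space.span_base imageI)
    finally show ?thesis .
  qed
  then have "card (g ` S) \<le> card (h ` B)"
    using fun_space.independent_span_bound[of "h ` B" "g ` S"] ind(1) finB by blast
  also have "\<dots> \<le> card B" using finB by (rule card_image_le)
  finally have "14 \<le> vec.dim U" using cardS ind(2) B(4) by (simp add: card_image)
  moreover have "vec.dim U \<le> 14" using vec.dim_subset_UNIV[of U] by (simp add: vec.dimension_def card_cart_basis)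
  ultimately have "vec.dim U = vec.dimension TYPE('a) TYPE(14)" by (simp add: vec.dimension_def card_cart_basis)
  then show ?thesis unfolding U_def by (simp add: vec.dim_eq_full)
qed

section \<open>Transitivity\<close>

definition mult_map :: "'a alg_closure \<Rightarrow> 'a ^ 14 \<Rightarrow> 'a ^ 14" where
  "mult_map y v = inv_into UNIV \<Psi> (ext_mult y (\<Psi> v))"

lemma \<Psi>_mult_map:
  assumes "y \<in> K6"
  shows "\<Psi> (mult_map y v) = ext_mult y (\<Psi> v)"
  unfolding mult_map_def using ext_mult_in_ext_space[OF assms, of "\<Psi> v"] range_\<Psi> by (intro \<Psi>_inv) auto

lemma mult_map_linear:
  assumes "y \<in> K6"
  shows "Vector_Spaces.linear (*s) (*s) (mult_map y)"
proof -
  have "\<Psi> (mult_map y (u + v)) = \<Psi> (mult_map y u + mult_map y v)"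
    "\<Psi> (mult_map y (c *s u)) = \<Psi> (c *s mult_map y u)" for u v c
    using assms by (simp_all add: \<Psi>_mult_map \<Psi>_add \<Psi>_scale ext_mult_def ext_scale_def distrib_left mult_ac)
  then have "mult_map y (u + v) = mult_map y u + mult_map y v" "mult_map y (c *s u) = c *s mult_map y u" for u v c
    using inj_\<Psi> by (simp_all add: inj_def)
  then show ?thesis using vec.vector_space_axioms by (simp add: Vector_Spaces.linear_iff)
qed

lemma mult_map_pvec:
  assumes "y \<in> K6" "x \<in> K6"
  shows "mult_map y (pvec x) = pvec (y * x)"
proof -
  have "\<Psi> (mult_map y (pvec x)) = \<Psi> (pvec (y * x))"
    using assms by (simp add: \<Psi>_mult_map \<Psi>_pvec K6_mult ext_mult_point_vec)
  then show ?thesis using inj_\<Psi> by (simp add: inj_def)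
qed

lemma mult_map_inverse:
  assumes "y \<in> K6 - {0}"
  shows "mult_map y (mult_map (1 / y) v) = v" "mult_map (1 / y) (mult_map y v) = v"
proof -
  have y: "y \<in> K6" "1 / y \<in> K6" "y * (1 / y) = 1" "1 / y * y = 1"
    using assms by (auto simp: frob.K6_def)
  have "\<Psi> (mult_map y (mult_map (1 / y) v)) = \<Psi> v" "\<Psi> (mult_map (1 / y) (mult_map y v)) = \<Psi> v"
    by (simp_all only: \<Psi>_mult_map[OF y(1)] \<Psi>_mult_map[OF y(2)] ext_mult_ext_mult y(3,4) ext_mult_1)
  then show "mult_map y (mult_map (1 / y) v) = v" "mult_map (1 / y) (mult_map y v) = v"
    using inj_\<Psi> by (simp_all add: inj_def)
qed

lemma transitive_pset: "transitive_pointset pset"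
  unfolding transitive_pointset_def
proof (intro ballI)
  fix p p' assume "p \<in> pset" "p' \<in> pset"
  then obtain x x' where x: "x \<in> K6 - {0}" "p = pnt x" and x': "x' \<in> K6 - {0}" "p' = pnt x'"
    by (auto simp: pset_def)
  define y where "y = x' / x"
  have y: "y \<in> K6 - {0}" "y * x = x'" using x x' by (auto simp: y_def K6_divide)
  have y1: "1 / y \<in> K6" using y(1) by (auto simp: frob.K6_def)
  define A where "A = matrix (mult_map y)"
  define A' where "A' = matrix (mult_map (1 / y))"
  have Av: "A *v v = mult_map y v" "A' *v v = mult_map (1 / y) v" for v
    unfolding A_def A'_def using y y1 by (simp_all add: matrix_works mult_map_linear)
  have "A ** A' = mat 1" "A' ** A = mat 1"
    unfolding matrix_eq by (simp_all add: Av mult_map_inverse[OF y(1)] flip: matrix_vector_mul_assoc)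
  then have "invertible A" unfolding invertible_def by blast
  have proj: "projectivity A (pnt z) = pnt (y * z)" if "z \<in> K6" for z
  proof -
    have lin: "mult_map y (k *s v) = k *s mult_map y v" for k v
      using mult_map_linear[of y] y(1) by (simp add: Vector_Spaces.linear_iff)
    show ?thesis
      unfolding projectivity_def pnt_def Av vec.span_singleton image_image lin
      using mult_map_pvec[of y z] y(1) that by simp
  qed
  have "projectivity A ` pset = pset"
  proof -
    have "projectivity A ` pset = pnt ` (\<lambda>z. y * z) ` (K6 - {0})"
      unfolding pset_def image_image by (intro image_cong) (auto simp: proj)
    also have "(\<lambda>z. y * z) ` (K6 - {0}) = K6 - {0}"
    proof
      show "(\<lambda>z. y * z) ` (K6 - {0}) \<subseteq> K6 - {0}" using y(1) by (auto simp: K6_mult)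
      show "K6 - {0} \<subseteq> (\<lambda>z. y * z) ` (K6 - {0})"
      proof
        fix z :: "'a alg_closure" assume "z \<in> K6 - {0}"
        then show "z \<in> (\<lambda>z. y * z) ` (K6 - {0})"
          using y(1) by (intro image_eqI[of _ _ "z / y"]) (auto simp: K6_divide)
      qed
    qed
    finally show ?thesis by (simp add: pset_def)
  qed
  moreover have "projectivity A p = p'" using proj[of x] x x' y(2) by simp
  ultimately show "\<exists>A. invertible A \<and> projectivity A ` pset = pset \<and> projectivity A p = p'"
    using \<open>invertible A\<close> by blast
qed

section \<open>A solid with exactly five points\<close>

lemma exists_five_point_solid: "\<exists>W\<in>proj_subspaces 3. card (pts_in pset W) = 5"
proof -
  obtain e :: "'a alg_closure" where e: "frob (frob (frob e)) = e" "e \<noteq> 0" "frob (frob e / e) \<noteq> frob e / e"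
    by (rule exists_cubic_generator)
  obtain \<eta> :: "'a alg_closure" where \<eta>: "frob (frob \<eta>) = \<eta>" "\<eta> + frob \<eta> = 1" "frob \<eta> \<noteq> \<eta>"
    by (rule exists_quadratic_trace_1)
  define \<sigma> where "\<sigma> = frob e / e"
  have \<sigma>: "frob \<sigma> \<noteq> \<sigma>" using e(3) by (simp add: \<sigma>_def)
  define \<rho> where "\<rho> = frob (frob e) / frob e"
  have \<rho>\<sigma>: "\<rho> = frob \<sigma>" by (simp add: \<rho>_def \<sigma>_def)
  have \<rho>: "frob (frob (frob \<rho>)) = \<rho>" "\<rho> * frob \<rho> * frob (frob \<rho>) = 1" "frob \<rho> \<noteq> \<rho>"
  proof -
    show "frob (frob (frob \<rho>)) = \<rho>" "\<rho> * frob \<rho> * frob (frob \<rho>) = 1"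
      using e(1,2) by (simp_all add: \<rho>_def)
    show "frob \<rho> \<noteq> \<rho>" using \<sigma> by (simp add: \<rho>\<sigma>)
  qed
  obtain l \<mu> t where l: "frob l = l" and \<mu>: "frob \<mu> = \<mu>" "\<mu> \<noteq> 0" and t: "t \<in> K6"
    "frob (frob (frob t)) \<noteq> t" "t * frob (frob (frob t)) = \<mu>"
    "t + frob (frob (frob t)) = l + \<rho> + 1 / \<rho>"
    "t * frob (frob t) * frob (frob (frob (frob t)))
      + frob t * frob (frob (frob t)) * frob (frob (frob (frob (frob t)))) = \<mu> * (l + 2)"
    by (rule frob.conjugate_pair_exists[OF \<rho> \<eta> quadratic_has_root])
  define s where "s = frob (frob (frob t))"
  have s3: "frob (frob (frob s)) = t" using t(1) by (simp add: s_def frob.K6_def)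
  have st: "s \<noteq> t" using t(2) by (simp add: s_def)
  have t_nz: "t \<noteq> 0" "s \<noteq> 0" using t(3) \<mu>(2) by (auto simp: s_def)
  have in_K6: "(1 :: 'a alg_closure) \<in> K6" "e \<in> K6" "1 / e \<in> K6" "t \<in> K6" "s \<in> K6"
    using e(1) t(1) by (simp_all add: frob.K6_def s_def)
  define r where "r x = frob x / x" for x :: "'a alg_closure"
  have r1: "r 1 = 1" "r e = \<sigma>" "r (1 / e) = 1 / \<sigma>" using e(2) by (simp_all add: r_def \<sigma>_def)
  have \<sigma>1: "\<sigma> \<noteq> 1" "\<sigma> \<noteq> - 1" "\<sigma> \<noteq> 0" using \<sigma> by auto
  have \<sigma>2: "1 / \<sigma> \<noteq> 1" "1 / \<sigma> \<noteq> \<sigma>"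
  proof -
    show "1 / \<sigma> \<noteq> 1" using \<sigma>1 by (simp add: divide_eq_eq)
    show "1 / \<sigma> \<noteq> \<sigma>"
    proof
      assume "1 / \<sigma> = \<sigma>"
      then have "\<sigma> * \<sigma> = 1" using \<sigma>1(3) by (metis nonzero_divide_eq_eq)
      then show False using \<sigma>1 by (simp add: square_eq_1_iff)
    qed
  qed
  \<comment> \<open>Factors from F_q preserve F_(q^3), so an element outside it never names the same
    point as a nonzero element inside.\<close>
  have cubic: "r z \<noteq> r y" if yz: "y \<noteq> 0" "z \<noteq> 0" "frob (frob (frob y)) = y" "frob (frob (frob z)) \<noteq> z" for y z
  proof
    assume "r z = r y"
    then obtain c where "z = to_ac c * y" using frob_ratio_eq[of z y] yz(1,2) by (auto simp: r_def)
    then show False using yz by simp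
  qed
  \<comment> \<open>If t = c s with c in F_q, the cube of \<open>frob\<close> gives s = c t, so c is
    1 or -1. Then t + s = 0 would be fixed by \<open>frob\<close>, contrary to
    \<open>frob_plus_inverse_neq\<close>.\<close>
  have rts: "r t \<noteq> r s"
  proof
    assume "r t = r s"
    then obtain c where c: "t = to_ac c * s" using frob_ratio_eq[of t s] t_nz by (auto simp: r_def)
    have "s = to_ac c * t" using arg_cong[OF c, of "\<lambda>x. frob (frob (frob x))"] s3 by (simp add: s_def)
    then have "to_ac c * to_ac c * s = s" using c by (simp add: mult.assoc)
    then have "to_ac c * to_ac c = 1" using t_nz by simp
    then have "to_ac c = 1 \<or> to_ac c = - 1" by (simp add: square_eq_1_iff)
    then have "t = - s" using c st by auto
    then have "t + s = 0" by simp
    then have "l + \<rho> + 1 / \<rho> = 0" using t(4)[folded s_def] by metis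
    then show False using frob.frob_plus_inverse_neq[OF \<rho>(1,3) l] by simp
  qed
  have neq: "r t \<noteq> r 1" "r t \<noteq> r e" "r t \<noteq> r (1 / e)" "r s \<noteq> r 1" "r s \<noteq> r e" "r s \<noteq> r (1 / e)"
  proof -
    have "frob (frob (frob s)) \<noteq> s" using s3 st by simp
    then have c: "r t \<noteq> r y" "r s \<noteq> r y" if "y \<noteq> 0" "frob (frob (frob y)) = y" for y
      using cubic that t_nz t(2) by blast+
    show "r t \<noteq> r 1" "r t \<noteq> r e" "r t \<noteq> r (1 / e)" "r s \<noteq> r 1" "r s \<noteq> r e" "r s \<noteq> r (1 / e)"
      by (rule c; use e(1,2) in simp)+
  qed
  define T where "T = {1, e, 1 / e, t}"
  have inj5: "inj_on r (insert s T)"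
    unfolding T_def using neq neq[symmetric] rts rts[symmetric] \<sigma>1 \<sigma>2 \<sigma>2[symmetric] r1 by (auto simp: inj_on_def)
  then have injT: "inj_on (\<lambda>x. frob x / x) T" unfolding r_def[abs_def] by (rule inj_on_subset) auto
  have distinct: "1 \<noteq> e" "1 \<noteq> 1 / e" "1 \<noteq> t" "e \<noteq> 1 / e" "e \<noteq> t" "1 / e \<noteq> t" "s \<notin> T"
    using neq rts \<sigma>1 \<sigma>2 r1 unfolding T_def by auto
  have cardT: "card T = 4" unfolding T_def using distinct by simp
  have TK: "T \<subseteq> K6 - {0}" "insert s T \<subseteq> K6 - {0}" using in_K6 e(2) t_nz by (auto simp: T_def)
  have finT: "finite T" by (simp add: T_def)
  note indep = pvec_independent[OF TK(1) finT _ injT]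
  define W where "W = vec.span (pvec ` T)"
  have subW: "vec.subspace W" by (simp add: W_def)
  have dimW: "vec.dim W = 4"
    unfolding W_def using indep cardT by (simp add: vec.dim_eq_card_independent card_image)
  have sumT: "(\<Sum>x\<in>T. c x *s pvec x) = c 1 *s pvec 1 + c e *s pvec e + c (1 / e) *s pvec (1 / e) + c t *s pvec t" for c
    unfolding T_def using distinct by (simp add: add.assoc)
  have \<Psi>_comb: "\<Psi> (a *s pvec 1 + b *s pvec e + c *s pvec (1 / e) + d *s pvec t)
      = ext_scale a (point_vec 1) + ext_scale b (point_vec e) + ext_scale c (point_vec (1 / e)) + ext_scale d (point_vec t)" for a b c d
    using in_K6 by (simp add: \<Psi>_add \<Psi>_scale \<Psi>_pvec)
  \<comment> \<open>The count has to be exactly 5, so both inclusions matter: the five-term relation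
    brings in s, and the span argument excludes further points.\<close>
  have "pts_in pset W = pnt ` insert s T"
  proof
    have "pvec s \<in> W"
    proof -
      define \<nu> where "\<nu> = e * frob e * frob (frob e)"
      have "frob \<nu> = \<nu>" using e(1) by (simp add: \<nu>_def mult_ac)
      then have fx: "frob (\<mu> * l) = \<mu> * l" "frob (\<mu> / \<nu>) = \<mu> / \<nu>" "frob (\<mu> * \<nu>) = \<mu> * \<nu>"
        using \<mu> l by simp_all
      obtain a b c where abc: "\<mu> * l = to_ac a" "\<mu> / \<nu> = to_ac b" "\<mu> * \<nu> = to_ac c"
        using fx by (metis obtain_to_ac)
      note dep = frob.point_vec_dependency[OF e(1,2) \<rho>_def t(1,3,4,5) \<mu>(1) l \<nu>_def, folded s_def, unfolded abc]
      have "\<Psi> (pvec s) = \<Psi> (a *s pvec 1 + b *s pvec e + c *s pvec (1 / e) + (- 1) *s pvec t)"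
        unfolding \<Psi>_comb \<Psi>_pvec[OF in_K6(5)] using dep by (simp add: prod_eq_iff ext_scale_def)
      then have "pvec s = a *s pvec 1 + b *s pvec e + c *s pvec (1 / e) + (- 1) *s pvec t"
        using inj_\<Psi> unfolding inj_def by blast
      also have "\<dots> \<in> W"
        unfolding W_def T_def by (intro vec.span_add vec.span_scale vec.span_base) auto
      finally show ?thesis .
    qed
    moreover have "pvec x \<in> W" if "x \<in> T" for x using that unfolding W_def by (intro vec.span_base) auto
    ultimately show "pnt ` insert s T \<subseteq> pts_in pset W"
      using TK(2) pnt_subset_iff[OF subW] by (auto simp: pts_in_def pset_def)
    show "pts_in pset W \<subseteq> pnt ` insert s T"
    proof
      fix p assume "p \<in> pts_in pset W"
      then obtain x where x: "x \<in> K6 - {0}" "p = pnt x" "pvec x \<in> W"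
        using pnt_subset_iff[OF subW] by (auto simp: pts_in_def pset_def)
      have ex: "p \<in> pnt ` insert s T" if "y \<in> insert s T" "r x = r y" for y
      proof -
        have "pnt x = pnt y" using pnt_eq_iff[of x y] x(1) TK(2) that by (auto simp: r_def)
        then show ?thesis using x(2) that(1) by blast
      qed
      obtain u where "pvec x = (\<Sum>v\<in>pvec ` T. u v *s v)"
        using x(3) finT unfolding W_def by (auto simp: vec.span_finite)
      also have "\<dots> = (\<Sum>y\<in>T. u (pvec y) *s pvec y)" using indep(1) cardT by (simp add: sum.reindex)
      finally obtain a b c d where comb: "pvec x = a *s pvec 1 + b *s pvec e + c *s pvec (1 / e) + d *s pvec t"
        unfolding sumT by blast
      show "p \<in> pnt ` insert s T"
      \<comment> \<open>Without t a new point would be dependent on 1, e, 1/e, against the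
        independence of four points; with t, the first two coordinates alone force x to be an
        F_q-multiple of t or s.\<close>
      proof (cases "d = 0")
        case True
        show ?thesis
        proof (rule ccontr)
          assume np: "p \<notin> pnt ` insert s T"
          then have rx: "r x \<noteq> r 1" "r x \<noteq> r e" "r x \<noteq> r (1 / e)" using ex by (auto simp: T_def)
          then have d': "x \<noteq> 1" "x \<noteq> e" "x \<noteq> 1 / e" by auto
          \<comment> \<open>The final \<open>c\<close> is the coefficient at \<open>1 / e\<close>;
            the value -1 at x brings \<open>pvec x\<close> to the other side.\<close>
          define f where "f y = (if y = x then - 1 else if y = 1 then a else if y = e then b else c)" for y
          have "(\<Sum>y\<in>{x, 1, e, 1 / e}. f y *s pvec y) = 0"
            using d' d'[symmetric] distinct distinct(1,2,4)[symmetric] True comb by (simp add: f_def add.assoc)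
          moreover have "inj_on r {x, 1, e, 1 / e}"
            using rx rx[symmetric] \<sigma>1 \<sigma>2 \<sigma>2[symmetric] r1 by (auto simp: inj_on_def)
          ultimately have "f x = 0"
            using x(1) in_K6 e(2) card_insert_le_m1[of 4]
            by (intro pvec_scalars_zero[of "{x, 1, e, 1 / e}" f])
              (auto simp: r_def[abs_def] card_insert_if)
          then show False by (simp add: f_def)
        qed
      next
        case False
        have "point_vec x = \<Psi> (pvec x)" using x(1) by (simp add: \<Psi>_pvec)
        also have "\<dots> = ext_scale a (point_vec 1) + ext_scale b (point_vec e) + ext_scale c (point_vec (1 / e)) + ext_scale d (point_vec t)"
          unfolding comb by (rule \<Psi>_comb)
        finally have pv: "point_vec x = ext_scale a (point_vec 1) + ext_scale b (point_vec e) + ext_scale c (point_vec (1 / e)) + ext_scale d (point_vec t)" .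
        have A: "fst (point_vec x) = to_ac a * fst (point_vec 1) + to_ac b * fst (point_vec e)
            + to_ac c * fst (point_vec (1 / e)) + to_ac d * fst (point_vec t)"
          unfolding pv by (simp add: ext_scale_def)
        have B: "fst (snd (point_vec x)) = to_ac a * fst (snd (point_vec 1)) + to_ac b * fst (snd (point_vec e))
            + to_ac c * fst (snd (point_vec (1 / e))) + to_ac d * fst (snd (point_vec t))"
          unfolding pv by (simp add: ext_scale_def)
        have x': "x \<in> K6" "x \<noteq> 0" and d: "to_ac d \<noteq> 0" using x(1) False by auto
        obtain k where k: "frob k = k" "k \<noteq> 0" "x = k * t \<or> x = k * s"
          by (rule frob.span_point_vec_conjugates[OF e(1,2) \<rho>_def \<rho>(3) t(1-4) \<mu>(1) l x'
            frob_to_ac frob_to_ac frob_to_ac frob_to_ac d A B, folded s_def])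
        then have "r x = r t \<or> r x = r s" by (auto simp: r_def)
        then show ?thesis using ex by (auto simp: T_def)
      qed
    qed
  qed
  moreover have "inj_on pnt (insert s T)"
  proof (rule inj_onI)
    fix x y assume xy: "x \<in> insert s T" "y \<in> insert s T" "pnt x = pnt y"
    then have "r x = r y" using pnt_eq_iff[of x y] TK(2) by (auto simp: r_def)
    then show "x = y" using inj5 xy(1,2) by (simp only: inj_on_def)
  qed
  ultimately have "card (pts_in pset W) = 5"
    using cardT finT distinct(7) by (simp add: card_image)
  moreover have "W \<in> proj_subspaces 3" using subW dimW by (simp add: proj_subspaces_def)
  ultimately show ?thesis by blast
qed

end

(* HOL-Algebra uses X as notation for an indeterminate. *)
no_notation var (\<open>X\<index>\<close>)

theorem mainTheorem20:
  fixes q :: nat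
  assumes "q = CARD('a::{field,finite})"
  shows "\<exists>X :: ('a ^ 14) set set.
           card X = (q ^ 6 - 1) div (q - 1) \<and> rs_set 3 2 X \<and> transitive_pointset X"
proof -
  obtain \<Psi> :: "'a ^ 14 \<Rightarrow> 'a alg_closure \<times> 'a alg_closure \<times> 'a alg_closure"
    where "ext_coordinates \<Psi>" by (rule ext_coordinates_exist)
  then interpret ext_coordinates \<Psi> .
  have "card pset * (q - 1) = q ^ 6 - 1" using card_pset assms by simp
  then have "card pset = (q ^ 6 - 1) div (q - 1)"
    using card_field_gt_1[where 'a = 'a] assms by (metis nonzero_mult_div_cancel_right less_numeral_extra(3) zero_less_diff)
  moreover have "rs_set 3 2 pset"
    unfolding rs_set_def
    using pset_subset_proj_points card_pts_in_plane span_pset exists_five_point_solid by simp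
  ultimately show ?thesis using transitive_pset by blast
qed

end
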